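(* Let $\gamma>1$ be the Salem number that is a root of $x^4-x^3-x^2-x+1$, and let $\theta,\bar\theta$ be the two non-real (unimodular) roots of this polynomial. For each integer $m\ge 1$ define $$b_{0,m}=b_{4,m}=1,\qquad b_{1,m}=b_{3,m}=-(\gamma^m+\gamma^{-m}+\theta^m+\bar\theta^m),$$ $$b_{2,m}=2+\theta^m\gamma^m+\theta^m\gamma^{-m}+\bar\theta^m\gamma^m+\bar\theta^m\gamma^{-m},$$ so that $x^4+b_{1,m}x^3+b_{2,m}x^2+b_{3,m}x+1$ is the minimal polynomial of $\gamma^m$. For integers $n\ge 1$ let $$T_{2n+8,m}(x)=x^{n+4}\left(\sum_{j=0}^4 b_{j,m}\left(x^{n+j}+\frac{1}{x^{n+j}}\right)+2\right).$$ Let $LC(T_{2n+8,m})=\lim_{n\to\infty}C(T_{2n+8,m})$. Then $$\lim_{m\to\infty} LC(T_{2n+8,m})=0.$$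
   Context: For a polynomial $P$ of degree $d$, $C(P)$ denotes the number of complex zeros of $P$ (counted with multiplicity) whose modulus is different from $1$, divided by $d$. *)

theory Defs
  imports "HOL-Analysis.Analysis" "HOL-Computational_Algebra.Computational_Algebra"
begin

definition is_min_poly_rat :: "rat poly \<Rightarrow> complex \<Rightarrow> bool" where
  "is_min_poly_rat p a \<longleftrightarrow>
     lead_coeff p = 1 \<and> poly (map_poly of_rat p) a = 0 \<and>
     (\<forall>q. q \<noteq> 0 \<and> poly (map_poly of_rat q) a = 0 \<longrightarrow> degree p \<le> degree q)"

definition salem_number :: "real \<Rightarrow> bool" where
  "salem_number \<gamma> \<longleftrightarrow>
     \<gamma> > 1 \<and> algebraic_int \<gamma> \<and>
     (\<exists>p. is_min_poly_rat p (of_real \<gamma>) \<and>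
       (\<forall>z. poly (map_poly of_rat p) z = 0 \<and> z \<noteq> of_real \<gamma> \<longrightarrow> cmod z \<le> 1) \<and>
       (\<exists>z. poly (map_poly of_rat p) z = 0 \<and> z \<noteq> of_real \<gamma> \<and> cmod z = 1))"

definition salem_quartic :: "complex poly" where
  "salem_quartic = [:1, -1, -1, -1, 1:]"

lemma poly_salem_quartic: "poly salem_quartic x = x^4 - x^3 - x^2 - x + 1"
  by (simp add: salem_quartic_def algebra_simps power_numeral_reduce)

definition bcoeff :: "real \<Rightarrow> complex \<Rightarrow> nat \<Rightarrow> nat \<Rightarrow> complex" where
  "bcoeff \<gamma> \<theta> j m =
     (let g = complex_of_real \<gamma> in
      if j = 0 \<or> j = 4 then 1
      else if j = 1 \<or> j = 3 then
        - (g ^ m + inverse g ^ m + \<theta> ^ m + cnj \<theta> ^ m)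
      else if j = 2 then
        2 + \<theta> ^ m * g ^ m + \<theta> ^ m * inverse g ^ m
          + cnj \<theta> ^ m * g ^ m + cnj \<theta> ^ m * inverse g ^ m
      else 0)"

definition Bpoly :: "real \<Rightarrow> complex \<Rightarrow> nat \<Rightarrow> complex poly" where
  "Bpoly \<gamma> \<theta> m =
     [:1, bcoeff \<gamma> \<theta> 3 m, bcoeff \<gamma> \<theta> 2 m, bcoeff \<gamma> \<theta> 1 m, 1:]"

text \<open>The polynomial \<open>T\<^bsub>2n+8,m\<^esub>\<close>, with the outer factor \<open>x ^ (n + 4)\<close> multiplied out;
  \<open>poly_Tpoly\<close> below recovers the Laurent form.\<close>

definition Tpoly :: "real \<Rightarrow> complex \<Rightarrow> nat \<Rightarrow> nat \<Rightarrow> complex poly" where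
  "Tpoly \<gamma> \<theta> n m =
     (\<Sum>j\<le>4. monom (bcoeff \<gamma> \<theta> j m) (2 * n + 4 + j) + monom (bcoeff \<gamma> \<theta> j m) (4 - j))
     + monom 2 (n + 4)"

lemma poly_Tpoly:
  assumes "x \<noteq> 0"
  shows "poly (Tpoly \<gamma> \<theta> n m) x =
    x ^ (n + 4) * ((\<Sum>j\<le>4. bcoeff \<gamma> \<theta> j m * (x ^ (n + j) + 1 / x ^ (n + j))) + 2)"
proof -
  have *: "x ^ (n + 4) * (bcoeff \<gamma> \<theta> j m * (x ^ (n + j) + 1 / x ^ (n + j))) =
      bcoeff \<gamma> \<theta> j m * x ^ (2 * n + 4 + j) + bcoeff \<gamma> \<theta> j m * x ^ (4 - j)"
    if "j \<le> 4" for j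
  proof -
    have "x ^ (n + 4) = x ^ (4 - j) * x ^ (n + j)"
      using that by (simp add: add.commute flip: power_add)
    then have "x ^ (n + 4) * (1 / x ^ (n + j)) = x ^ (4 - j)"
      using assms by simp
    moreover have "x ^ (n + 4) * x ^ (n + j) = x ^ (2 * n + 4 + j)"
      by (simp add: mult_2 algebra_simps flip: power_add)
    ultimately show ?thesis
      by (metis distrib_left mult.left_commute)
  qed
  have "(\<Sum>j\<le>4. bcoeff \<gamma> \<theta> j m * x ^ (2 * n + 4 + j) + bcoeff \<gamma> \<theta> j m * x ^ (4 - j)) =
      x ^ (n + 4) * (\<Sum>j\<le>4. bcoeff \<gamma> \<theta> j m * (x ^ (n + j) + 1 / x ^ (n + j)))"
    unfolding sum_distrib_left by (intro sum.cong refl *[symmetric]) simp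
  then show ?thesis
    by (simp only: Tpoly_def poly_add poly_sum poly_monom distrib_left[of _ _ 2]) simp
qed

lemma degree_Tpoly: "degree (Tpoly \<gamma> \<theta> n m) = 2 * n + 8"
proof (rule antisym)
  show "degree (Tpoly \<gamma> \<theta> n m) \<le> 2 * n + 8"
    unfolding Tpoly_def
    by (intro degree_add_le degree_sum_le finite_atMost; (rule order.trans[OF degree_monom_le])?) auto
  have "coeff (Tpoly \<gamma> \<theta> n m) (2 * n + 8) = 1"
    by (simp add: Tpoly_def coeff_sum bcoeff_def numeral_eq_Suc)
  then show "2 * n + 8 \<le> degree (Tpoly \<gamma> \<theta> n m)"
    by (intro le_degree) simp
qed

definition Cratio :: "complex poly \<Rightarrow> real" where
  "Cratio P = real (size {#z \<in># proots P. cmod z \<noteq> 1#}) / real (degree P)"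

definition LC :: "real \<Rightarrow> complex \<Rightarrow> nat \<Rightarrow> real" where
  "LC \<gamma> \<theta> m = lim (\<lambda>n. Cratio (Tpoly \<gamma> \<theta> n m))"

end

theory Submission
  imports Defs "HOL-Real_Asymp.Real_Asymp"
begin

text \<open>
  Put \<open>w = \<gamma> ^ m + \<gamma> ^ -m\<close> and \<open>v = 2 Re (\<theta> ^ m)\<close>, so that \<open>w > 2 \<ge> \<bar>v\<bar>\<close>. On the unit circle, with \<open>N = n + 2\<close>,
  \<open>T (e^(it)) = 2 e^(i(N+2)t) (b t cos (N t) + 1)\<close> where \<open>b t = (2 cos t - w) (2 cos t - v)\<close>.
  There are no zeros where \<open>\<bar>b\<bar> < 1\<close>; where \<open>\<bar>b\<bar> > 1\<close> there is, for large \<open>N\<close>, exactly one simple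
  zero in each interval between consecutive multiples of \<open>pi / N\<close>; and near the finitely many points
  with \<open>\<bar>b\<bar> = 1\<close> such an interval carries boundedly many zeros, by Rolle's theorem applied twice. Hence the
  proportion of zeros off the circle converges to the relative length of \<open>{t. \<bar>b t\<bar> < 1}\<close>.
  As \<open>m\<close> grows, \<open>w\<close> tends to infinity and this set shrinks to the two points with \<open>2 cos t = v\<close>.

  The numbers \<open>w\<close> and \<open>v\<close> are conjugate in \<open>\<rat>(sqrt 13)\<close>, which gives the minimal polynomial
  \<open>(x\<^sup>2 - w x + 1) (x\<^sup>2 - v x + 1)\<close> of \<open>\<gamma> ^ m\<close>.
\<close>

section \<open>Multiple roots on the unit circle\<close>

lemma inj_on_cis: "inj_on cis {-pi<..pi}"
  by (rule inj_on_inverseI[of _ Arg]) (rule Arg_cis)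

lemma linear_power_dvd_pderiv:
  fixes p :: "'a::idom poly"
  assumes "[:-z, 1:] ^ Suc k dvd p"
  shows "[:-z, 1:] ^ k dvd pderiv p"
proof -
  obtain q where "p = [:-z, 1:] ^ Suc k * q"
    using assms by (auto elim: dvdE)
  then have "pderiv p = [:-z, 1:] ^ k * (smult (of_nat (Suc k)) q + [:-z, 1:] * pderiv q)"
    by (simp only: pderiv_mult pderiv_power_Suc) (simp add: pderiv_pCons algebra_simps)
  then show ?thesis
    by simp
qed

text \<open>Differentiating p(e^(it)) = e^(idt) F(t) in t turns p into i (x p' - d p) and F into F',
  with the same phase factor, so the lemma can be iterated.\<close>

lemma polar_form_vector_derivative:
  fixes p :: "complex poly" and d :: nat
  assumes F: "\<And>t. cis (real d * t) * F t = poly p (cis t)"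
    and F': "(F has_vector_derivative F' t) (at t)"
  shows "cis (real d * t) * F' t = poly (smult \<i> ([:0, 1:] * pderiv p - smult (of_nat d) p)) (cis t)"
proof -
  have cis': "((\<lambda>t. cis (c * t)) has_vector_derivative \<i> * of_real c * cis (c * t)) (at t)" for c t
    unfolding cis_conv_exp by (auto intro!: derivative_eq_intros has_vector_derivative_real_field)
  have "((\<lambda>t. cis (real d * t) * F t) has_vector_derivative
          (cis (real d * t) * F' t + \<i> * of_real (real d) * cis (real d * t) * F t)) (at t)"
    by (rule has_vector_derivative_mult[OF cis' F'])
  moreover have "((\<lambda>t. poly p (cis t)) has_vector_derivative (\<i> * cis t * poly (pderiv p) (cis t))) (at t)"
    using field_vector_diff_chain_at[OF cis'[of 1 t], of "poly p"] by (simp add: o_def)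
  ultimately have "cis (real d * t) * F' t + \<i> * of_real (real d) * (cis (real d * t) * F t)
      = \<i> * cis t * poly (pderiv p) (cis t)"
    unfolding F by (metis (no_types, lifting) F mult.assoc vector_derivative_unique_at)
  then show ?thesis
    unfolding F by (simp add: algebra_simps)
qed

text \<open>The operator q -> i (x q' - d q) lowers the order of a root by at most one. A double
  root on the circle therefore survives in the polynomial belonging to \<open>f'\<close>, a triple
  root in the one belonging to \<open>f''\<close>. This turns non-vanishing of real derivatives into
  bounds on complex multiplicities.\<close>

lemma polar_form_multiple_root:
  fixes p :: "complex poly" and d :: nat
  assumes F: "\<And>t. cis (real d * t) * of_real (f t) = poly p (cis t)"
    and f': "\<And>t. (f has_real_derivative f' t) (at t)"
    and f'': "\<And>t. (f' has_real_derivative f'' t) (at t)"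
  shows "[:-cis t, 1:] ^ 2 dvd p \<Longrightarrow> f' t = 0"
    and "[:-cis t, 1:] ^ 3 dvd p \<Longrightarrow> f'' t = 0"
proof -
  define D where "D q = smult \<i> ([:0, 1:] * pderiv q - smult (of_nat d) q)" for q
  have D_dvd: "[:-cis t, 1:] ^ k dvd D q" if "[:-cis t, 1:] ^ Suc k dvd q" for k q
    unfolding D_def using linear_power_dvd_pderiv[OF that] dvd_trans[OF le_imp_power_dvd that, of k]
    by (intro dvd_smult dvd_diff dvd_mult) auto
  have root: "y = 0" if "cis (real d * t) * of_real y = poly q (cis t)" "[:-cis t, 1:] ^ 1 dvd q" for y :: real and q
    using that by (metis cis_neq_zero mult_eq_0_iff of_real_eq_0_iff poly_eq_0_iff_dvd power_one_right)
  have 1: "cis (real d * t) * of_real (f' t) = poly (D p) (cis t)" for t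
    unfolding D_def by (rule polar_form_vector_derivative[OF F]) (use f' in \<open>auto intro!: has_vector_derivative_of_real
      simp flip: has_real_derivative_iff_has_vector_derivative\<close>)
  have 2: "cis (real d * t) * of_real (f'' t) = poly (D (D p)) (cis t)" for t
    unfolding D_def[of "D p"] by (rule polar_form_vector_derivative[OF 1]) (use f'' in \<open>auto intro!: has_vector_derivative_of_real
      simp flip: has_real_derivative_iff_has_vector_derivative\<close>)
  show "f' t = 0" if "[:-cis t, 1:] ^ 2 dvd p"
    using that by (intro root[OF 1[of t]] D_dvd) (simp add: numeral_2_eq_2)
  show "f'' t = 0" if "[:-cis t, 1:] ^ 3 dvd p"
    using that by (intro root[OF 2[of t]] D_dvd) (simp add: numeral_3_eq_3)
qed

section \<open>Monotonicity cells of the cosine\<close>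

lemma cos_shift_npi_int: "cos (x + pi * of_int k) = cos x * cos (pi * of_int k)"
  by (simp add: cos_add)

text \<open>Translating by a multiple of pi changes the cosine only by a sign and moves the cell to
  [0, pi], where the cosine decreases.\<close>

lemma cos_between_on_cell:
  fixes k :: int
  assumes "pi * of_int k \<le> x" "x \<le> w" "w \<le> z" "z \<le> pi * (of_int k + 1)"
  shows "min (cos x) (cos z) \<le> cos w \<and> cos w \<le> max (cos x) (cos z)"
proof -
  define s where "s = pi * of_int k"
  have "cos (z - s) \<le> cos (w - s)" "cos (w - s) \<le> cos (x - s)"
    using assms by (auto intro!: cos_monotone_0_pi_le simp: s_def algebra_simps)
  moreover have "cos y = cos (y - s) * cos s" for y
    using cos_shift_npi_int[of "y - s" k] by (simp add: s_def)
  moreover have "cos s = 1 \<or> cos s = -1"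
    by (simp add: s_def)
  ultimately show ?thesis
    by (metis add.inverse_inverse max.coboundedI1 max.coboundedI2 min.coboundedI1 min.coboundedI2 mult.right_neutral mult_minus_right neg_le_iff_le)
qed

text \<open>The cells are the intervals of monotonicity of \<open>cos (N * t)\<close>.\<close>

definition cell :: "nat \<Rightarrow> real \<Rightarrow> int" where
  "cell N t = \<lfloor>real N * t / pi\<rfloor>"

lemma cell_bounds:
  "pi * of_int (cell N t) \<le> real N * t" "real N * t \<le> pi * (of_int (cell N t) + 1)"
proof -
  have "of_int (cell N t) \<le> real N * t / pi" "real N * t / pi \<le> of_int (cell N t) + 1"
    unfolding cell_def by linarith+
  then show "pi * of_int (cell N t) \<le> real N * t" "real N * t \<le> pi * (of_int (cell N t) + 1)"
    by (simp_all add: pos_le_divide_eq pos_divide_le_eq mult.commute)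
qed

lemma cos_between_same_cell:
  fixes w x z :: real
  assumes "cell N x = cell N z" "x \<le> w" "w \<le> z"
  shows "min (cos (N * x)) (cos (N * z)) \<le> cos (N * w) \<and> cos (N * w) \<le> max (cos (N * x)) (cos (N * z))"
  using cell_bounds[where t = x and N = N] cell_bounds[where t = z and N = N] assms
  by (intro cos_between_on_cell[of "cell N x"]) (auto intro: mult_left_mono)

text \<open>An interval of length c - a meets at most (c - a) N / pi + 2 cells. In the applications
  \<open>p\<close> bounds the number of distinct zeros in a cell and \<open>q\<close> the
  multiplicity of each.\<close>

lemma sum_le_by_cells:
  fixes h :: "real \<Rightarrow> nat"
  assumes "finite S" "S \<subseteq> {a<..c}" "a \<le> c" "N > 0"
    and p: "\<And>k. card {t\<in>S. cell N t = k} \<le> p"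
    and q: "\<And>t. t \<in> S \<Longrightarrow> h t \<le> q"
  shows "real (sum h S) \<le> real (p * q) * ((c - a) * N / pi + 2)"
proof -
  have sub: "cell N ` S \<subseteq> {cell N a..cell N c}"
    using assms(2,4) by (auto simp: cell_def subset_eq intro!: floor_mono divide_right_mono)
  have "card S = (\<Sum>k\<in>cell N ` S. card {t\<in>S. cell N t = k})"
    using sum.image_gen[OF assms(1), of "\<lambda>_. 1::nat" "cell N"] by simp
  also have "\<dots> \<le> (\<Sum>k\<in>cell N ` S. p)"
    by (intro sum_mono p)
  also have "\<dots> \<le> card {cell N a..cell N c} * p"
    using card_mono[OF _ sub] by simp
  finally have card: "card S \<le> nat (cell N c - cell N a + 1) * p"
    by (simp add: add.commute)
  have "cell N a \<le> cell N c"
    using assms by (auto simp: cell_def intro!: floor_mono divide_right_mono)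
  then have "real (nat (cell N c - cell N a + 1)) = of_int (cell N c) - of_int (cell N a) + 1"
    by simp
  also have "\<dots> \<le> (c - a) * N / pi + 2"
    unfolding cell_def by (simp add: diff_divide_distrib left_diff_distrib mult.commute[of "real N"]) linarith
  finally have nat: "real (nat (cell N c - cell N a + 1)) \<le> (c - a) * N / pi + 2" .
  have "sum h S \<le> (\<Sum>t\<in>S. q)"
    by (intro sum_mono q)
  also have "\<dots> \<le> nat (cell N c - cell N a + 1) * p * q"
    using card by simp
  finally have "sum h S \<le> nat (cell N c - cell N a + 1) * p * q" .
  then have "real (sum h S) \<le> real (nat (cell N c - cell N a + 1)) * real (p * q)"
    by (metis mult.assoc of_nat_mono of_nat_mult)
  also have "\<dots> \<le> ((c - a) * N / pi + 2) * real (p * q)"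
    using nat by (intro mult_right_mono) auto
  finally show ?thesis
    by (simp add: mult.commute)
qed

lemma bounded_on_interval:
  fixes g :: "real \<Rightarrow> real"
  assumes "continuous_on {a..c} g"
  obtains B where "B \<ge> 0" "\<And>t. t \<in> {a..c} \<Longrightarrow> \<bar>g t\<bar> \<le> B"
proof -
  have "bounded (g ` {a..c})"
    by (intro compact_imp_bounded compact_continuous_image assms) auto
  then obtain B where "\<forall>x\<in>g ` {a..c}. \<bar>x\<bar> \<le> B"
    unfolding bounded_real by blast
  then show ?thesis
    by (intro that[of "max 0 B"]) force+
qed

text \<open>The lower bound has the exact slope, whereas the upper bound may lose any slope
  \<open>e\<close>, with a constant depending on \<open>e\<close>. This slack absorbs the short
  pieces near |b| = 1, where only crude counts are available.\<close>

lemma tendsto_ratio_squeeze: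
  fixes X :: "nat \<Rightarrow> real" and K L :: real
  assumes lower: "\<And>N. N > 0 \<Longrightarrow> X N \<ge> L * N - K"
    and upper: "\<And>e. e > 0 \<Longrightarrow> \<exists>K::real. \<forall>\<^sub>F N in sequentially. X N \<le> (L + e) * N + K"
  shows "(\<lambda>N. X N / N) \<longlonglongrightarrow> L"
proof (rule order_tendstoI)
  have ev: "\<forall>\<^sub>F N in sequentially. real N > y" for y
    using filterlim_real_sequentially by (rule filterlim_at_top_dense[THEN iffD1, rule_format])
  show "\<forall>\<^sub>F N in sequentially. x < X N / N" if "x < L" for x
    using ev[of "K / (L - x)"] eventually_gt_at_top[of 0]
  proof eventually_elim
    case (elim N)
    then show ?case
      using lower[of N] that by (simp add: field_simps)
  qed
  show "\<forall>\<^sub>F N in sequentially. X N / N < x" if "L < x" for x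
  proof -
    define e where "e = (x - L) / 2"
    have e: "e > 0" "x = L + 2 * e"
      using that by (auto simp: e_def field_simps)
    then obtain K where "\<forall>\<^sub>F N in sequentially. X N \<le> (L + e) * N + K"
      using upper by blast
    then show ?thesis
      using ev[of "K / e"] eventually_gt_at_top[of 0]
    proof eventually_elim
      case (elim N)
      then have "X N < (L + 2 * e) * N"
        using e(1) by (simp add: field_simps)
      then show ?case
        using elim(3) e(2) by (simp add: field_simps)
    qed
  qed
qed

section \<open>Zeros of a modulated cosine\<close>

text \<open>The last assumption says that on the unit circle \<open>P N\<close> is a unimodular
  factor times a real function, so its unimodular zeros are those of the real function. Finiteness
  of the level set isolates the transition points |b| = 1.\<close>

locale cosine_modulation =
  fixes b b' b'' :: "real \<Rightarrow> real" and P :: "nat \<Rightarrow> complex poly" and d :: "nat \<Rightarrow> nat"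
  assumes deriv_b: "(b has_real_derivative b' t) (at t)"
    and deriv_b': "(b' has_real_derivative b'' t) (at t)"
    and cont_b'': "continuous_on UNIV b''"
    and finite_level: "finite {t\<in>{-pi..pi}. \<bar>b t\<bar> = 1}"
    and P_nonzero: "P N \<noteq> 0"
    and poly_P: "poly (P N) (cis t) = cis (real (d N) * t) * of_real (2 * (b t * cos (real N * t) + 1))"
begin

definition f :: "nat \<Rightarrow> real \<Rightarrow> real" where
  "f N t = b t * cos (real N * t) + 1"

definition f' :: "nat \<Rightarrow> real \<Rightarrow> real" where
  "f' N t = b' t * cos (real N * t) - real N * b t * sin (real N * t)"

definition f'' :: "nat \<Rightarrow> real \<Rightarrow> real" where
  "f'' N t = b'' t * cos (real N * t) - 2 * real N * b' t * sin (real N * t)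
     - (real N)\<^sup>2 * b t * cos (real N * t)"

lemma deriv_f: "(f N has_real_derivative f' N t) (at t)"
  unfolding f_def f'_def by (auto intro!: derivative_eq_intros deriv_b)

lemma deriv_f': "(f' N has_real_derivative f'' N t) (at t)"
  unfolding f'_def f''_def
  by (auto intro!: derivative_eq_intros deriv_b deriv_b' simp: algebra_simps power2_eq_square)

lemma continuous_b: "continuous_on S b"
  by (rule DERIV_continuous_on[of S "b" "b'"]) (rule has_field_derivative_at_within[OF deriv_b])

lemma continuous_b': "continuous_on S b'"
  by (rule DERIV_continuous_on[of S "b'" "b''"]) (rule has_field_derivative_at_within[OF deriv_b'])

lemma continuous_f: "continuous_on S (f N)"
  by (rule DERIV_continuous_on[of S "f N" "f' N"]) (rule has_field_derivative_at_within[OF deriv_f])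

lemma continuous_f': "continuous_on S (f' N)"
  by (rule DERIV_continuous_on[of S "f' N" "f'' N"]) (rule has_field_derivative_at_within[OF deriv_f'])

section \<open>Counting unimodular zeros with multiplicity\<close>

definition mult :: "nat \<Rightarrow> real \<Rightarrow> nat" where
  "mult N t = order (cis t) (P N)"

text \<open>Half-open intervals make the count additive under subdivision, and (-pi, pi] covers the
  circle exactly once.\<close>

definition Z :: "nat \<Rightarrow> real \<Rightarrow> real \<Rightarrow> nat" where
  "Z N a c = (\<Sum>t\<in>{t\<in>{a<..c}. f N t = 0}. mult N t)"

lemma poly_P_eq_0_iff: "poly (P N) (cis t) = 0 \<longleftrightarrow> f N t = 0"
  unfolding poly_P f_def[symmetric] by simp

lemma mult_pos: "f N t = 0 \<Longrightarrow> mult N t \<ge> 1"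
  unfolding mult_def using P_nonzero poly_P_eq_0_iff by (metis One_nat_def Suc_leI order_gt_0_iff)

lemma dvd_P: "k \<le> mult N t \<Longrightarrow> [:-cis t, 1:] ^ k dvd P N"
  unfolding mult_def order_divides by simp

lemma mult_le_1: "f' N t \<noteq> 0 \<Longrightarrow> mult N t \<le> 1"
  and mult_le_2: "f'' N t \<noteq> 0 \<Longrightarrow> mult N t \<le> 2"
proof -
  have polar: "cis (real (d N) * t) * of_real (2 * f N t) = poly (P N) (cis t)" for t
    by (simp add: poly_P f_def)
  have d1: "((\<lambda>t. 2 * f N t) has_real_derivative 2 * f' N t) (at t)" for t
    using deriv_f by (auto intro!: derivative_eq_intros)
  have d2: "((\<lambda>t. 2 * f' N t) has_real_derivative 2 * f'' N t) (at t)" for t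
    using deriv_f' by (auto intro!: derivative_eq_intros)
  show "mult N t \<le> 1" if "f' N t \<noteq> 0"
    using polar_form_multiple_root(1)[OF polar d1 d2 dvd_P, of t] that by fastforce
  show "mult N t \<le> 2" if "f'' N t \<noteq> 0"
    using polar_form_multiple_root(2)[OF polar d1 d2 dvd_P, of t] that by fastforce
qed

lemma finite_zeros:
  assumes "-pi \<le> a" "c \<le> pi"
  shows "finite {t\<in>{a<..c}. f N t = 0}"
proof (rule inj_on_finite)
  show "inj_on cis {t\<in>{a<..c}. f N t = 0}"
    using assms by (intro inj_on_subset[OF inj_on_cis]) auto
  show "cis ` {t\<in>{a<..c}. f N t = 0} \<subseteq> {z. poly (P N) z = 0}"
    by (auto simp: poly_P_eq_0_iff)
  show "finite {z. poly (P N) z = 0}"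
    by (rule poly_roots_finite[OF P_nonzero])
qed

lemma Z_split:
  assumes "-pi \<le> a" "a \<le> x" "x \<le> c" "c \<le> pi"
  shows "Z N a c = Z N a x + Z N x c"
proof -
  have "{t\<in>{a<..c}. f N t = 0} = {t\<in>{a<..x}. f N t = 0} \<union> {t\<in>{x<..c}. f N t = 0}"
    using assms by auto
  moreover have "{t\<in>{a<..x}. f N t = 0} \<inter> {t\<in>{x<..c}. f N t = 0} = {}"
    by auto
  ultimately show ?thesis
    unfolding Z_def using assms by (simp only: sum.union_disjoint finite_zeros)
qed

lemma Z_full: "Z N (-pi) pi = (\<Sum>z | poly (P N) z = 0 \<and> cmod z = 1. order z (P N))"
proof -
  have "bij_betw cis {t\<in>{-pi<..pi}. f N t = 0} {z. poly (P N) z = 0 \<and> cmod z = 1}"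
    unfolding bij_betw_def
  proof
    show "inj_on cis {t\<in>{-pi<..pi}. f N t = 0}"
      by (intro inj_on_subset[OF inj_on_cis]) auto
    have "z \<in> cis ` {t\<in>{-pi<..pi}. f N t = 0}" if "poly (P N) z = 0" "cmod z = 1" for z
    proof
      show z: "z = cis (Arg z)"
        using that cis_Arg[of z] by (cases "z = 0") (auto simp: sgn_eq)
      show "Arg z \<in> {t\<in>{-pi<..pi}. f N t = 0}"
        using z that(1) Arg_bounded[of z] poly_P_eq_0_iff[of N "Arg z"] by auto
    qed
    then show "cis ` {t\<in>{-pi<..pi}. f N t = 0} = {z. poly (P N) z = 0 \<and> cmod z = 1}"
      by (auto simp: poly_P_eq_0_iff)
  qed
  then show ?thesis
    unfolding Z_def mult_def by (intro sum.reindex_bij_betw)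
qed

lemma Z_eq_0:
  assumes "\<And>t. t \<in> {a<..c} \<Longrightarrow> \<bar>b t\<bar> < 1"
  shows "Z N a c = 0"
proof -
  have "f N t \<noteq> 0" if "t \<in> {a<..c}" for t
  proof -
    have "\<bar>b t * cos (real N * t)\<bar> \<le> \<bar>b t\<bar> * 1"
      unfolding abs_mult by (intro mult_left_mono) auto
    then show ?thesis
      using assms[OF that] by (auto simp: f_def)
  qed
  then have "{t\<in>{a<..c}. f N t = 0} = {}"
    by blast
  then show ?thesis
    by (simp only: Z_def sum.empty)
qed

section \<open>Lower bound for the number of zeros\<close>

lemma nonvanishing_sign:
  assumes "connected S" "\<And>t. t \<in> S \<Longrightarrow> b t \<noteq> 0"
  shows "(\<forall>t\<in>S. b t > 0) \<or> (\<forall>t\<in>S. b t < 0)"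
proof (rule ccontr)
  assume "\<not> ?thesis"
  then obtain x y where xy: "x \<in> S" "y \<in> S" "b x \<le> 0" "b y \<ge> 0"
    by (meson not_less)
  have "connected (b ` S)"
    by (rule connected_continuous_image[OF continuous_b assms(1)])
  then have "0 \<in> b ` S"
    using xy by (meson connectedD_interval imageI)
  then show False
    using assms(2) by auto
qed

text \<open>At consecutive multiples of pi / N the factor cos (N t) takes the values 1 and -1 in
  some order, while b keeps its sign and exceeds 1 in modulus; so b cos (N t) + 1 changes sign in
  between. Only the open interval is constrained, so the endpoints may be transition points.\<close>

lemma Z_ge:
  assumes "-pi \<le> a" "a \<le> c" "c \<le> pi" "N > 0"
    and large: "\<And>t. t \<in> {a<..<c} \<Longrightarrow> \<bar>b t\<bar> > 1"
  shows "real (Z N a c) \<ge> (c - a) * N / pi - 2"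
proof -
  \<comment> \<open>These are the k for which both pi k / N and pi (k + 1) / N lie strictly between
    a and c, so |b| > 1 holds on the whole closed cell.\<close>
  define K where "K = {\<lfloor>N * a / pi\<rfloor> + 1..\<lceil>N * c / pi\<rceil> - 2}"
  define S where "S = {t\<in>{a<..c}. f N t = 0}"
  have zero: "\<exists>t\<in>S. cell N t = k" if k: "k \<in> K" for k
  proof -
    define x where "x = pi * of_int k / N"
    define y where "y = pi * (of_int k + 1) / N"
    have "real N * a / pi < of_int k" "of_int k + 1 < real N * c / pi"
      using k unfolding K_def by (simp_all, linarith+)
    then have xy: "a < x" "x < y" "y < c"
      using assms(4) by (auto simp: x_def y_def field_simps)
    have large': "\<bar>b t\<bar> > 1" if "t \<in> {x..y}" for t
      using xy that by (intro large) auto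
    have sgn: "(\<forall>t\<in>{x..y}. b t > 0) \<or> (\<forall>t\<in>{x..y}. b t < 0)"
      by (rule nonvanishing_sign) (use large' in force)+
    have "real N * x = pi * of_int k" "real N * y = pi * of_int (k + 1)"
      using assms(4) by (auto simp: x_def y_def)
    then have cxy: "cos (real N * x) = (if even k then 1 else -1)" "cos (real N * y) = (if even k then -1 else 1)"
      by (simp_all only: cos_npi_int) auto
    have "b x > 1 \<and> b y > 1 \<or> b x < -1 \<and> b y < -1"
    proof -
      have "b x > 0 \<and> b y > 0 \<or> b x < 0 \<and> b y < 0"
        using sgn xy(2) by (meson atLeastAtMost_iff less_imp_le order_refl)
      then show ?thesis
        using large'[of x] large'[of y] xy(2) by auto
    qed
    then have fxy: "f N x < 0 \<and> f N y > 0 \<or> f N x > 0 \<and> f N y < 0"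
      unfolding f_def cxy by (cases "even k") auto
    then have "\<exists>t. x \<le> t \<and> t \<le> y \<and> f N t = 0"
      using IVT'[OF _ _ _ continuous_f, of N x 0 y] IVT2'[OF _ _ _ continuous_f, of N y 0 x] xy
      by (meson less_imp_le)
    then obtain t where t: "x \<le> t" "t \<le> y" "f N t = 0"
      by blast
    \<comment> \<open>The zero avoids both cell boundaries, so different k give different
      zeros.\<close>
    with fxy have t': "x < t" "t < y"
      by (metis less_eq_real_def less_irrefl)+
    then have "pi * of_int k < real N * t" "real N * t < pi * (of_int k + 1)"
      using assms(4) by (auto simp: x_def y_def field_simps)
    then have "cell N t = k"
      unfolding cell_def by (intro floor_unique) (auto simp: field_simps)
    then show ?thesis
      using t t' xy by (intro bexI[of _ t]) (auto simp: S_def)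
  qed
  have fin: "finite S"
    unfolding S_def by (intro finite_zeros assms)
  have "K \<subseteq> cell N ` S"
    using zero by blast
  then have "card K \<le> card S"
    by (rule surj_card_le[OF fin])
  also have "card S \<le> Z N a c"
    unfolding Z_def S_def[symmetric] card_eq_sum by (rule sum_mono, rule mult_pos) (simp add: S_def)
  finally have "card K \<le> Z N a c" .
  moreover have "real (card K) \<ge> of_int (\<lceil>N * c / pi\<rceil> - 2 - \<lfloor>N * a / pi\<rfloor>)"
    unfolding K_def by simp
  moreover have "of_int (\<lceil>N * c / pi\<rceil> - 2 - \<lfloor>N * a / pi\<rfloor>) \<ge> N * c / pi - 2 - N * a / pi"
    by (simp, linarith)
  moreover have "(c - a) * N / pi = N * c / pi - N * a / pi"
    by (simp add: algebra_simps diff_divide_distrib)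
  ultimately show ?thesis
    by linarith
qed

section \<open>Upper bounds from Rolle's theorem\<close>

lemma Rolle_f:
  assumes "x < y" "f N x = 0" "f N y = 0"
  shows "\<exists>w>x. w < y \<and> f' N w = 0"
proof -
  have "\<exists>w. x < w \<and> w < y \<and> (*) (f' N w) = (\<lambda>_. 0)"
    using deriv_f assms by (intro Rolle_deriv[where f = "f N"] continuous_f) (auto simp: has_field_derivative_def)
  then show ?thesis
    by (metis mult.right_neutral)
qed

lemma Rolle_f':
  assumes "x < y" "f' N x = 0" "f' N y = 0"
  shows "\<exists>w>x. w < y \<and> f'' N w = 0"
proof -
  have "\<exists>w. x < w \<and> w < y \<and> (*) (f'' N w) = (\<lambda>_. 0)"
    using deriv_f' assms by (intro Rolle_deriv[where f = "f' N"] continuous_f') (auto simp: has_field_derivative_def)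
  then show ?thesis
    by (metis mult.right_neutral)
qed

text \<open>A cosine bounded away from 1 in modulus forces |sin (N t)| to be at least some \<sigma>
  > 0, and then the term N b sin (N t) outgrows b' cos (N t). Zeros of \<open>f\<close> satisfy the
  cosine bound, since there cos (N t) = -1 / b.\<close>

lemma eventually_f'_nonzero:
  assumes "\<delta> > 0" and large: "\<And>t. t \<in> {a..c} \<Longrightarrow> \<bar>b t\<bar> \<ge> 1 + \<delta>"
  shows "\<forall>\<^sub>F N in sequentially. \<forall>t\<in>{a..c}. \<bar>cos (real N * t)\<bar> \<le> 1 / (1 + \<delta>) \<longrightarrow> f' N t \<noteq> 0"
proof -
  obtain B where B: "\<And>t. t \<in> {a..c} \<Longrightarrow> \<bar>b' t\<bar> \<le> B"
    using bounded_on_interval[OF continuous_b', of a c] by metis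
  define \<sigma> where "\<sigma> = sqrt (1 - (1 / (1 + \<delta>))\<^sup>2)"
  have "(1 / (1 + \<delta>))\<^sup>2 < 1"
    using assms(1) by (simp add: power_less_one_iff abs_square_less_1)
  then have \<sigma>: "\<sigma> > 0"
    by (simp add: \<sigma>_def)
  have nz: "f' N t \<noteq> 0" if N: "real N > B / \<sigma>" and t: "t \<in> {a..c}" and c: "\<bar>cos (real N * t)\<bar> \<le> 1 / (1 + \<delta>)" for N t
  proof
    assume "f' N t = 0"
    then have eq: "real N * (\<bar>b t\<bar> * \<bar>sin (real N * t)\<bar>) = \<bar>b' t\<bar> * \<bar>cos (real N * t)\<bar>"
      by (simp add: f'_def flip: abs_mult) (simp add: abs_mult mult.assoc)
    have "(cos (real N * t))\<^sup>2 \<le> (1 / (1 + \<delta>))\<^sup>2"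
      using c by (metis abs_ge_zero power2_abs power_mono)
    then have "\<sigma> \<le> sqrt ((sin (real N * t))\<^sup>2)"
      unfolding \<sigma>_def sin_squared_eq by simp
    then have "\<bar>b t\<bar> * \<bar>sin (real N * t)\<bar> \<ge> 1 * \<sigma>"
      using large[OF t] assms(1) \<sigma> by (intro mult_mono) auto
    then have "real N * (\<bar>b t\<bar> * \<bar>sin (real N * t)\<bar>) \<ge> real N * \<sigma>"
      by (intro mult_left_mono) auto
    moreover have "\<bar>b' t\<bar> * \<bar>cos (real N * t)\<bar> \<le> B * 1"
      using B[OF t] by (intro mult_mono) auto
    ultimately show False
      using eq N \<sigma> by (simp add: field_simps)
  qed
  have "\<forall>\<^sub>F N in sequentially. real N > B / \<sigma>"
    using filterlim_real_sequentially by (rule filterlim_at_top_dense[THEN iffD1, rule_format])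
  then show ?thesis
    by eventually_elim (use nz in blast)
qed

text \<open>When neither b nor the cosine is small, the term of order N^2 in \<open>f''\<close>
  dominates the terms of order N and 1.\<close>

lemma eventually_f''_nonzero:
  assumes "\<And>t. t \<in> {a..c} \<Longrightarrow> \<bar>b t\<bar> \<ge> 1 / 2"
  shows "\<forall>\<^sub>F N in sequentially. \<forall>t\<in>{a..c}. \<bar>cos (real N * t)\<bar> \<ge> 1 / 2 \<longrightarrow> f'' N t \<noteq> 0"
proof -
  obtain B where B: "B \<ge> 0" "\<And>t. t \<in> {a..c} \<Longrightarrow> \<bar>b' t\<bar> \<le> B"
    using bounded_on_interval[OF continuous_b', of a c] by metis
  obtain B2 where B2: "B2 \<ge> 0" "\<And>t. t \<in> {a..c} \<Longrightarrow> \<bar>b'' t\<bar> \<le> B2"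
    using bounded_on_interval[OF continuous_on_subset[OF cont_b''], of a c] by auto
  \<comment> \<open>A zero of \<open>f''\<close> would give N^2 / 4 <= B2 + 2 N B <= N (B2 + 2 B),
    that is N <= 8 B + 4 B2. The extra 1 secures N >= 1, used in B2 <= B2 N.\<close>
  have nz: "f'' N t \<noteq> 0" if N: "real N > 8 * B + 4 * B2 + 1" and t: "t \<in> {a..c}" and c: "\<bar>cos (real N * t)\<bar> \<ge> 1 / 2" for N t
  proof
    assume "f'' N t = 0"
    then have "(real N)\<^sup>2 * (b t * cos (real N * t)) = b'' t * cos (real N * t) - 2 * real N * b' t * sin (real N * t)"
      by (simp add: f''_def mult.assoc)
    then have "\<bar>(real N)\<^sup>2 * (b t * cos (real N * t))\<bar> \<le> \<bar>b'' t * cos (real N * t)\<bar> + \<bar>2 * real N * b' t * sin (real N * t)\<bar>"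
      by linarith
    then have le: "(real N)\<^sup>2 * (\<bar>b t\<bar> * \<bar>cos (real N * t)\<bar>) \<le>
        \<bar>b'' t\<bar> * \<bar>cos (real N * t)\<bar> + 2 * real N * (\<bar>b' t\<bar> * \<bar>sin (real N * t)\<bar>)"
      by (simp add: abs_mult mult.assoc)
    have "\<bar>b'' t\<bar> * \<bar>cos (real N * t)\<bar> \<le> B2 * 1" "\<bar>b' t\<bar> * \<bar>sin (real N * t)\<bar> \<le> B * 1"
      using B2 B t by (auto intro!: mult_mono simp del: mult_1_right)
    moreover have "\<bar>b t\<bar> * \<bar>cos (real N * t)\<bar> \<ge> (1 / 2) * (1 / 2)"
      using assms[OF t] c by (intro mult_mono) auto
    then have "(real N)\<^sup>2 * (\<bar>b t\<bar> * \<bar>cos (real N * t)\<bar>) \<ge> (real N)\<^sup>2 * (1 / 4)"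
      by (intro mult_left_mono) auto
    ultimately have "(real N)\<^sup>2 * (1 / 4) \<le> B2 + 2 * real N * B"
      using le mult_left_mono[of "\<bar>b' t\<bar> * \<bar>sin (real N * t)\<bar>" B "2 * real N"] by linarith
    moreover have "B2 * 1 \<le> B2 * real N"
      using B2 N B by (intro mult_left_mono) auto
    ultimately have "real N * real N \<le> real N * (8 * B + 4 * B2)"
      by (simp add: power2_eq_square algebra_simps)
    then show False
      using N B B2 by (simp add: mult_le_cancel_left)
  qed
  have "\<forall>\<^sub>F N in sequentially. real N > 8 * B + 4 * B2 + 1"
    using filterlim_real_sequentially by (rule filterlim_at_top_dense[THEN iffD1, rule_format])
  then show ?thesis
    by eventually_elim (use nz in blast)
qed

lemma cos_at_zero: "f N t = 0 \<Longrightarrow> cos (real N * t) = - 1 / b t"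
  unfolding f_def by (cases "b t = 0") (auto simp: field_simps)

text \<open>Two zeros in one cell would enclose a zero of \<open>f'\<close>. Since cos (N t) is
  monotone on the cell, it obeys there the same bound as at the two zeros, where \<open>f'\<close>
  cannot vanish. For the same reason each zero is simple.\<close>

lemma eventually_Z_le:
  assumes "-pi \<le> a" "a \<le> c" "c \<le> pi" "\<delta> > 0"
    and large: "\<And>t. t \<in> {a..c} \<Longrightarrow> \<bar>b t\<bar> \<ge> 1 + \<delta>"
  shows "\<forall>\<^sub>F N in sequentially. real (Z N a c) \<le> (c - a) * N / pi + 2"
proof -
  have "\<forall>\<^sub>F N in sequentially. \<forall>t\<in>{a..c}. \<bar>cos (real N * t)\<bar> \<le> 1 / (1 + \<delta>) \<longrightarrow> f' N t \<noteq> 0"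
    using assms(4) large by (rule eventually_f'_nonzero)
  then show ?thesis
    using eventually_gt_at_top[of 0]
  proof eventually_elim
    case (elim N)
    define S where "S = {t\<in>{a<..c}. f N t = 0}"
    have fin: "finite S"
      unfolding S_def by (intro finite_zeros assms)
    have cos_S: "\<bar>cos (real N * t)\<bar> \<le> 1 / (1 + \<delta>)" if "t \<in> S" for t
      using that large[of t] cos_at_zero[of N t] assms(4) by (auto simp: S_def intro!: divide_left_mono)
    have uniq: False if xy: "x \<in> S" "y \<in> S" "x < y" "cell N x = cell N y" for x y
    proof -
      obtain w where w: "x < w" "w < y" "f' N w = 0"
        using Rolle_f[of x y N] xy by (auto simp: S_def)
      have "\<bar>cos (real N * w)\<bar> \<le> 1 / (1 + \<delta>)"
        using cos_between_same_cell[OF xy(4), of w] w cos_S[OF xy(1)] cos_S[OF xy(2)] by linarith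
      then show False
        using elim(1) w xy by (auto simp: S_def)
    qed
    have "real (sum (mult N) S) \<le> real (1 * 1) * ((c - a) * N / pi + 2)"
    proof (rule sum_le_by_cells[OF fin _ assms(2) elim(2)])
      show "card {t\<in>S. cell N t = k} \<le> 1" for k
        using fin uniq by (subst card_le_Suc0_iff_eq[unfolded One_nat_def[symmetric]]) (auto, metis linorder_cases)
      show "mult N t \<le> 1" if "t \<in> S" for t
        using elim(1) cos_S[OF that] that by (intro mult_le_1) (auto simp: S_def)
    qed (auto simp: S_def)
    then show ?case
      by (simp add: Z_def S_def)
  qed
qed

text \<open>Near |b| = 1 zeros may sit close to extrema of cos (N t), where \<open>f'\<close> can
  vanish too, but \<open>f''\<close> cannot. Three zeros in a cell would produce a zero of
  \<open>f''\<close> by applying Rolle twice, so a cell has at most 2 zeros, each of multiplicity at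
  most 2. The resulting factor 4 is harmless because the bound is used on arbitrarily short
  intervals.\<close>

lemma eventually_Z_le_crude:
  assumes "-pi \<le> a" "a \<le> c" "c \<le> pi"
    and b_bounds: "\<And>t. t \<in> {a..c} \<Longrightarrow> 1 / 2 \<le> \<bar>b t\<bar> \<and> \<bar>b t\<bar> \<le> 2"
  shows "\<forall>\<^sub>F N in sequentially. real (Z N a c) \<le> 4 * ((c - a) * N / pi + 2)"
proof -
  have "\<forall>\<^sub>F N in sequentially. \<forall>t\<in>{a..c}. \<bar>cos (real N * t)\<bar> \<ge> 1 / 2 \<longrightarrow> f'' N t \<noteq> 0"
    using b_bounds by (intro eventually_f''_nonzero) blast
  then show ?thesis
    using eventually_gt_at_top[of 0]
  proof eventually_elim
    case (elim N)
    define S where "S = {t\<in>{a<..c}. f N t = 0}"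
    have fin: "finite S"
      unfolding S_def by (intro finite_zeros assms)
    have "(\<forall>t\<in>{a..c}. b t > 0) \<or> (\<forall>t\<in>{a..c}. b t < 0)"
      by (rule nonvanishing_sign) (use b_bounds in force)+
    \<comment> \<open>The common sign matters: a value between two such cosines then also stays away
      from 0.\<close>
    then have cos_S: "(\<forall>t\<in>S. cos (real N * t) \<ge> 1 / 2) \<or> (\<forall>t\<in>S. cos (real N * t) \<le> - 1 / 2)"
    proof
      assume pos: "\<forall>t\<in>{a..c}. b t > 0"
      have "cos (real N * t) \<le> - 1 / 2" if "t \<in> S" for t
      proof -
        have "t \<in> {a..c}" "f N t = 0"
          using that by (auto simp: S_def)
        then show ?thesis
          using b_bounds[of t] pos cos_at_zero[of N t] by (auto simp: field_simps)
      qed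
      then show ?thesis by blast
    next
      assume neg: "\<forall>t\<in>{a..c}. b t < 0"
      have "cos (real N * t) \<ge> 1 / 2" if "t \<in> S" for t
      proof -
        have "t \<in> {a..c}" "f N t = 0"
          using that by (auto simp: S_def)
        then show ?thesis
          using b_bounds[of t] neg cos_at_zero[of N t] by (auto simp: field_simps)
      qed
      then show ?thesis by blast
    qed
    have uniq: False if S: "x \<in> S" "y \<in> S" "z \<in> S" and less: "x < y" "y < z" and cell: "cell N x = cell N z" for x y z
    proof -
      obtain u where u: "x < u" "u < y" "f' N u = 0"
        using Rolle_f[of x y N] S less by (auto simp: S_def)
      obtain v where v: "y < v" "v < z" "f' N v = 0"
        using Rolle_f[of y z N] S less by (auto simp: S_def)
      obtain w where w: "u < w" "w < v" "f'' N w = 0"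
        using Rolle_f'[of u v N] u v by auto
      have "\<bar>cos (real N * w)\<bar> \<ge> 1 / 2"
        proof -
        have "min (cos (real N * x)) (cos (real N * z)) \<le> cos (real N * w)"
          "cos (real N * w) \<le> max (cos (real N * x)) (cos (real N * z))"
          using cos_between_same_cell[OF cell, of w] u v w by auto
        moreover have "cos (real N * x) \<ge> 1 / 2 \<and> cos (real N * z) \<ge> 1 / 2 \<or>
          cos (real N * x) \<le> - 1 / 2 \<and> cos (real N * z) \<le> - 1 / 2"
          using cos_S S(1,3) by blast
        ultimately show ?thesis
          by linarith
      qed
      then show False
        using elim(1) w u v S by (auto simp: S_def)
    qed
    have "real (sum (mult N) S) \<le> real (2 * 2) * ((c - a) * N / pi + 2)"
    proof (rule sum_le_by_cells[OF fin _ assms(2) elim(2)])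
      show "card {t\<in>S. cell N t = k} \<le> 2" for k
      proof (rule ccontr)
        assume "\<not> card {t\<in>S. cell N t = k} \<le> 2"
        then have "card {t\<in>S. cell N t = k} \<ge> 3"
          by simp
        then obtain T where T: "T \<subseteq> {t\<in>S. cell N t = k}" "card T = 3"
          using obtain_subset_with_card_n by metis
        then obtain x y z where "T = {x, y, z}" "x \<noteq> y" "y \<noteq> z" "x \<noteq> z"
          by (auto simp: card_3_iff)
        then have "x \<in> S" "y \<in> S" "z \<in> S" "cell N x = k" "cell N y = k" "cell N z = k" "x \<noteq> y" "y \<noteq> z" "x \<noteq> z"
          using T by auto
        then show False
          using uniq by (metis linorder_cases)
      qed
      show "mult N t \<le> 2" if "t \<in> S" for t
      proof -
        have "\<bar>cos (real N * t)\<bar> \<ge> 1 / 2"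
          using cos_S that by fastforce
        then show ?thesis
          using elim(1) that by (intro mult_le_2) (auto simp: S_def)
      qed
    qed (auto simp: S_def)
    then show ?case
      by (simp add: Z_def S_def)
  qed
qed

section \<open>Limiting densities of zeros\<close>

lemma Z_tendsto_large:
  assumes "-pi \<le> a" "a \<le> c" "c \<le> pi"
    and large: "\<And>t. t \<in> {a..c} \<Longrightarrow> \<bar>b t\<bar> > 1"
  shows "(\<lambda>N. Z N a c / N) \<longlonglongrightarrow> (c - a) / pi"
proof -
  have "continuous_on {a..c} (\<lambda>t. \<bar>b t\<bar>)"
    by (intro continuous_intros continuous_b)
  then obtain y where y: "y \<in> {a..c}" "\<And>t. t \<in> {a..c} \<Longrightarrow> \<bar>b y\<bar> \<le> \<bar>b t\<bar>"
    using continuous_attains_inf[of "{a..c}" "\<lambda>t. \<bar>b t\<bar>"] assms(2) by auto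
  \<comment> \<open>By compactness |b| attains its minimum on the closed interval, which supplies a
    uniform margin above 1.\<close>
  have ev: "\<forall>\<^sub>F N in sequentially. real (Z N a c) \<le> (c - a) * N / pi + 2"
    using y large[OF y(1)] by (intro eventually_Z_le[where \<delta> = "\<bar>b y\<bar> - 1"] assms(1-3)) auto
  show ?thesis
  proof (rule tendsto_ratio_squeeze)
    show "real (Z N a c) \<ge> (c - a) / pi * N - 2" if "N > 0" for N
      using Z_ge[of a c N] that assms large by simp
    show "\<exists>K. \<forall>\<^sub>F N in sequentially. real (Z N a c) \<le> ((c - a) / pi + e) * N + K" if "e > 0" for e
    proof
      show "\<forall>\<^sub>F N in sequentially. real (Z N a c) \<le> ((c - a) / pi + e) * N + 2"
        using ev
      proof eventually_elim
        case (elim N)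
        have "e * real N \<ge> 0"
          using that by simp
        with elim show ?case
          by (simp add: distrib_right)
      qed
    qed
  qed
qed

text \<open>Here |b| may equal 1 at the endpoints, so there is no uniform margin. Short end pieces
  are cut off and counted crudely; the middle piece has the exact density.\<close>

lemma Z_tendsto_transition:
  assumes "-pi \<le> a" "a < c" "c \<le> pi"
    and large: "\<And>t. t \<in> {a<..<c} \<Longrightarrow> \<bar>b t\<bar> > 1"
    and b_bounds: "\<And>t. t \<in> {a..c} \<Longrightarrow> 1 / 2 \<le> \<bar>b t\<bar> \<and> \<bar>b t\<bar> \<le> 2"
  shows "(\<lambda>N. Z N a c / N) \<longlonglongrightarrow> (c - a) / pi"
proof (rule tendsto_ratio_squeeze)
  show "real (Z N a c) \<ge> (c - a) / pi * N - 2" if "N > 0" for N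
    using Z_ge[of a c N] that assms by simp
  show "\<exists>K. \<forall>\<^sub>F N in sequentially. real (Z N a c) \<le> ((c - a) / pi + e) * N + K" if "e > 0" for e
  proof -
    \<comment> \<open>The end pieces contribute slope 8 \<epsilon> / pi and the middle at most (c -
      a) / pi - \<epsilon> / pi, an excess of 7 \<epsilon> / pi. The second bound on \<epsilon>
      keeps the middle piece nonempty.\<close>
    define \<epsilon> where "\<epsilon> = min (e * pi / 7) ((c - a) / 3)"
    have \<epsilon>: "\<epsilon> > 0" "7 * \<epsilon> \<le> e * pi" "3 * \<epsilon> \<le> c - a"
      using that assms(2) by (auto simp: \<epsilon>_def min_def)
    have mid: "(\<lambda>N. Z N (a + \<epsilon>) (c - \<epsilon>) / N) \<longlonglongrightarrow> (c - \<epsilon> - (a + \<epsilon>)) / pi"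
      using assms \<epsilon> by (intro Z_tendsto_large) auto
    have "(c - \<epsilon> - (a + \<epsilon>)) / pi < (c - a) / pi - \<epsilon> / pi"
      using \<epsilon>(1) by (simp add: field_simps)
    then have 1: "\<forall>\<^sub>F N in sequentially. real (Z N (a + \<epsilon>) (c - \<epsilon>)) / N < (c - a) / pi - \<epsilon> / pi"
      by (rule order_tendstoD(2)[OF mid])
    have 2: "\<forall>\<^sub>F N in sequentially. real (Z N a (a + \<epsilon>)) \<le> 4 * ((a + \<epsilon> - a) * N / pi + 2)"
      using assms \<epsilon> by (intro eventually_Z_le_crude b_bounds) auto
    have 3: "\<forall>\<^sub>F N in sequentially. real (Z N (c - \<epsilon>) c) \<le> 4 * ((c - (c - \<epsilon>)) * N / pi + 2)"
      using assms \<epsilon> by (intro eventually_Z_le_crude b_bounds) auto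
    have "\<forall>\<^sub>F N in sequentially. real (Z N a c) \<le> ((c - a) / pi + e) * N + 16"
      using 1 2 3 eventually_gt_at_top[of 0]
    proof eventually_elim
      case (elim N)
      have "Z N a c = Z N a (a + \<epsilon>) + Z N (a + \<epsilon>) (c - \<epsilon>) + Z N (c - \<epsilon>) c"
        using assms \<epsilon> Z_split[of a "a + \<epsilon>" c N] Z_split[of "a + \<epsilon>" "c - \<epsilon>" c N] by simp
      moreover have "Z N (a + \<epsilon>) (c - \<epsilon>) \<le> ((c - a) / pi - \<epsilon> / pi) * N"
        using elim(1,4) by (simp add: field_simps)
      ultimately have "Z N a c \<le> ((c - a) / pi - \<epsilon> / pi) * N + 8 * (\<epsilon> / pi) * N + 16"
        using elim(2,3) by simp
      also have "\<dots> = ((c - a) / pi + 7 * \<epsilon> / pi) * N + 16"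
        by (simp add: algebra_simps)
      also have "\<dots> \<le> ((c - a) / pi + e) * N + 16"
        using \<epsilon>(2) by (intro add_right_mono mult_right_mono add_left_mono) (auto simp: field_simps)
      finally show ?case .
    qed
    then show ?thesis ..
  qed
qed

text \<open>Only the right endpoint can be a zero, as the left one is excluded from the count; a
  crude bound on a short last piece covers it.\<close>

lemma Z_tendsto_0:
  assumes "-pi \<le> a" "a < c" "c \<le> pi"
    and small: "\<And>t. t \<in> {a<..<c} \<Longrightarrow> \<bar>b t\<bar> < 1"
    and b_bounds: "\<And>t. t \<in> {a..c} \<Longrightarrow> 1 / 2 \<le> \<bar>b t\<bar> \<and> \<bar>b t\<bar> \<le> 2"
  shows "(\<lambda>N. Z N a c / N) \<longlonglongrightarrow> 0"
proof (rule tendsto_ratio_squeeze)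
  show "real (Z N a c) \<ge> 0 * real N - 0" for N
    by simp
  show "\<exists>K. \<forall>\<^sub>F N in sequentially. real (Z N a c) \<le> (0 + e) * real N + K" if "e > 0" for e
  proof -
    define \<epsilon> where "\<epsilon> = min (e * pi / 4) (c - a)"
    have \<epsilon>: "\<epsilon> > 0" "4 * \<epsilon> \<le> e * pi" "\<epsilon> \<le> c - a"
      using that assms(2) by (auto simp: \<epsilon>_def min_def)
    have "\<forall>\<^sub>F N in sequentially. real (Z N (c - \<epsilon>) c) \<le> 4 * ((c - (c - \<epsilon>)) * N / pi + 2)"
      using assms \<epsilon> by (intro eventually_Z_le_crude b_bounds) auto
    then have "\<forall>\<^sub>F N in sequentially. real (Z N a c) \<le> (0 + e) * real N + 8"
    proof eventually_elim
      case (elim N)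
      have "Z N a (c - \<epsilon>) = 0"
        using \<epsilon> by (intro Z_eq_0 small) auto
      then have "Z N a c \<le> 4 * \<epsilon> / pi * N + 8"
        using assms \<epsilon> Z_split[of a "c - \<epsilon>" c N] elim by simp
      also have "\<dots> \<le> (0 + e) * real N + 8"
        using \<epsilon>(2) by (intro add_right_mono mult_right_mono) (auto simp: field_simps)
      finally show ?case .
    qed
    then show ?thesis ..
  qed
qed

lemma Z_convergent_one_sided:
  assumes "-pi \<le> a" "a \<le> c" "c \<le> pi"
    and level: "\<And>t. t \<in> {a<..<c} \<Longrightarrow> \<bar>b t\<bar> \<noteq> 1"
    and b_bounds: "\<And>t. t \<in> {a..c} \<Longrightarrow> 1 / 2 \<le> \<bar>b t\<bar> \<and> \<bar>b t\<bar> \<le> 2"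
  shows "\<exists>L. (\<lambda>N. Z N a c / N) \<longlonglongrightarrow> L"
proof (cases "a = c")
  case True
  then show ?thesis
    by (auto simp: Z_def)
next
  case False
  have "(\<forall>t\<in>{a<..<c}. \<bar>b t\<bar> > 1) \<or> (\<forall>t\<in>{a<..<c}. \<bar>b t\<bar> < 1)"
  proof (rule ccontr)
    assume "\<not> ?thesis"
    then obtain x y where xy: "x \<in> {a<..<c}" "y \<in> {a<..<c}" "\<bar>b x\<bar> \<le> 1" "1 \<le> \<bar>b y\<bar>"
      by (meson not_less)
    have "connected ((\<lambda>t. \<bar>b t\<bar>) ` {a<..<c})"
      by (intro connected_continuous_image continuous_intros continuous_b) auto
    then have "1 \<in> (\<lambda>t. \<bar>b t\<bar>) ` {a<..<c}"
      using imageI[OF xy(1)] imageI[OF xy(2)] xy(3,4) by (rule connectedD_interval)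
    then show False
      using level by auto
  qed
  then show ?thesis
    proof
    assume large: "\<forall>t\<in>{a<..<c}. \<bar>b t\<bar> > 1"
    have "(\<lambda>N. Z N a c / N) \<longlonglongrightarrow> (c - a) / pi"
      using assms(1-3) False large by (intro Z_tendsto_transition b_bounds) auto
    then show ?thesis ..
  next
    assume small: "\<forall>t\<in>{a<..<c}. \<bar>b t\<bar> < 1"
    have "(\<lambda>N. Z N a c / N) \<longlonglongrightarrow> 0"
      using assms(1-3) False small by (intro Z_tendsto_0 b_bounds) auto
    then show ?thesis ..
  qed
qed

text \<open>Convergence passes to concatenated intervals by additivity of \<open>Z\<close> and holds
  on all sufficiently short intervals around each point; Bolzano's bisection principle then gives it
  on the whole circle.\<close>

lemma Z_convergent: "\<exists>L. (\<lambda>N. Z N (-pi) pi / N) \<longlonglongrightarrow> L"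
proof -
  \<comment> \<open>Intervals leaving [-pi, pi] are declared good, so neighbourhoods of the
    endpoints need no truncation.\<close>
  define good where "good a c \<longleftrightarrow> a < -pi \<or> c > pi \<or> (\<exists>L. (\<lambda>N. Z N a c / N) \<longlonglongrightarrow> L)" for a c
  have trans: "good a c" if g: "good a x" "good x c" "a \<le> x" "x \<le> c" for a x c
  proof (cases "a < -pi \<or> c > pi")
    case False
    then have "\<not> x > pi" "\<not> x < -pi"
      using g by linarith+
    then obtain L M where "(\<lambda>N. Z N a x / N) \<longlonglongrightarrow> L" "(\<lambda>N. Z N x c / N) \<longlonglongrightarrow> M"
      using g False unfolding good_def by blast
    then have "(\<lambda>N. Z N a x / N + Z N x c / N) \<longlonglongrightarrow> L + M"
      by (rule tendsto_add)
    moreover have "Z N a x / N + Z N x c / N = Z N a c / N" for N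
      using Z_split[of a x c N] g False by (simp add: add_divide_distrib)
    ultimately show ?thesis
      unfolding good_def by auto
  qed (auto simp: good_def)
  have "good (-pi) pi"
  proof (rule Bolzano[where P = good])
    show "good a c" if "good a x" "good x c" "a \<le> x" "x \<le> c" for a x c
      using that by (rule trans)
    fix x assume x: "-pi \<le> x" "x \<le> pi"
    have "isCont (\<lambda>t. \<bar>b t\<bar>) x"
      using DERIV_isCont[OF deriv_b] by (intro continuous_intros)
    then have cont: "\<forall>\<^sub>F t in nhds x. \<bar>b t\<bar> \<in> S" if "open S" "\<bar>b x\<bar> \<in> S" for S
      using that by (metis isCont_def tendsto_at_iff_tendsto_nhds topological_tendstoD)
    consider "\<bar>b x\<bar> > 1" | "\<bar>b x\<bar> < 1" | "\<bar>b x\<bar> = 1"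
      by linarith
    then show "\<exists>d>0. \<forall>a c. a \<le> x \<and> x \<le> c \<and> c - a < d \<longrightarrow> good a c"
    proof cases
      case 1
      then obtain d where d: "d > 0" "\<And>t. dist t x < d \<Longrightarrow> \<bar>b t\<bar> > 1"
        using cont[of "{1<..}"] by (auto simp: eventually_nhds_metric)
      have "good a c" if "a \<le> x" "x \<le> c" "c - a < d" for a c
      proof (cases "a < -pi \<or> c > pi")
        case False
        then have "(\<lambda>N. Z N a c / N) \<longlonglongrightarrow> (c - a) / pi"
          using that by (intro Z_tendsto_large d) (auto simp: dist_real_def)
        then show ?thesis
          by (auto simp: good_def)
      qed (auto simp: good_def)
      then show ?thesis
        using d(1) by blast
    next
      case 2
      then obtain d where d: "d > 0" "\<And>t. dist t x < d \<Longrightarrow> \<bar>b t\<bar> < 1"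
        using cont[of "{..<1}"] by (auto simp: eventually_nhds_metric)
      have "good a c" if "a \<le> x" "x \<le> c" "c - a < d" for a c
      proof -
        have "Z N a c = 0" for N
          using that by (intro Z_eq_0 d) (auto simp: dist_real_def)
        then show ?thesis
          by (auto simp: good_def)
      qed
      then show ?thesis
        using d(1) by blast
    next
      case 3
      then obtain d where d: "d > 0" "\<And>t. dist t x < d \<Longrightarrow> 1 / 2 < \<bar>b t\<bar> \<and> \<bar>b t\<bar> < 2"
        using cont[of "{1/2<..<2}"] by (auto simp: eventually_nhds_metric)
      obtain d' where d': "d' > 0" "\<And>t. t \<in> {-pi..pi} \<Longrightarrow> \<bar>b t\<bar> = 1 \<Longrightarrow> t \<noteq> x \<Longrightarrow> d' \<le> dist x t"
        using finite_set_avoid[OF finite_level, of x] by auto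
      \<comment> \<open>The only transition point in such an interval is x itself; splitting there
        leaves two one-sided intervals.\<close>
      have "good a c" if "a \<le> x" "x \<le> c" "c - a < min d d'" for a c
      proof (cases "a < -pi \<or> c > pi")
        case False
        have near: "dist t x < d" "dist x t < d'" if "t \<in> {a..c}" for t
          using that \<open>a \<le> x\<close> \<open>x \<le> c\<close> \<open>c - a < min d d'\<close> by (simp_all add: dist_real_def, linarith+)
        have bounds: "1 / 2 \<le> \<bar>b t\<bar> \<and> \<bar>b t\<bar> \<le> 2" if "t \<in> {a..c}" for t
          using d(2)[OF near(1)[OF that]] by linarith
        have level: "\<bar>b t\<bar> \<noteq> 1" if "t \<in> {a..c}" "t \<noteq> x" for t
          using d'(2)[of t] near(2)[OF that(1)] that False by fastforce
        have "good a x"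
          using that x False Z_convergent_one_sided[of a x] bounds level by (auto simp: good_def)
        moreover have "good x c"
          using that x False Z_convergent_one_sided[of x c] bounds level by (auto simp: good_def)
        ultimately show ?thesis
          using that by (intro trans[of a x c])
      qed (auto simp: good_def)
      then show ?thesis
        using d(1) d'(1) by (intro exI[of _ "min d d'"]) auto
    qed
  qed auto
  then show ?thesis
    by (auto simp: good_def)
qed

end

section \<open>Reciprocal quartics with a pair of roots on the circle\<close>

locale reciprocal_quartic =
  fixes w v :: real
  assumes w: "w > 2" and v: "\<bar>v\<bar> \<le> 2"
begin

definition Q :: "complex poly" where
  "Q = [:1, - of_real (w + v), of_real (2 + w * v), - of_real (w + v), 1:]"

text \<open>This is \<open>Tpoly\<close> with N = n + 2: the sum over x^(2n+4+j) is x^(2N) Q, and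
  the reflected sum is Q again because Q is palindromic.\<close>

definition T :: "nat \<Rightarrow> complex poly" where
  "T N = Q * (monom 1 (2 * N) + 1) + monom 2 (N + 2)"

definition b :: "real \<Rightarrow> real" where
  "b t = (2 * cos t - w) * (2 * cos t - v)"

text \<open>Q is the product of z^2 - u z + 1 over u = w, v, and on the circle each factor equals z
  (2 cos t - u).\<close>

lemma poly_Q_cis: "poly Q (cis t) = cis t ^ 2 * of_real (b t)"
proof -
  have 1: "cis t * cis (- t) = 1"
    by (simp add: cis_mult)
  have 2: "2 * complex_of_real (cos t) = cis t + cis (- t)"
    by (simp add: complex_eq_iff)
  have fac: "cis t * (cis t + cis (- t) - of_real u) = cis t ^ 2 - of_real u * cis t + 1" for u
    using 1 by (simp add: algebra_simps power2_eq_square)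
  have "cis t ^ 2 * of_real (b t) =
      (cis t * (cis t + cis (- t) - of_real w)) * (cis t * (cis t + cis (- t) - of_real v))"
    by (simp add: b_def 2 power2_eq_square)
  also have "\<dots> = poly Q (cis t)"
    unfolding fac by (simp add: Q_def algebra_simps power2_eq_square)
  finally show ?thesis ..
qed

lemma poly_T_cis: "poly (T N) (cis t) = cis (real (N + 2) * t) * of_real (2 * (b t * cos (real N * t) + 1))"
proof -
  have "cis t ^ (2 * N) + 1 = cis t ^ N * of_real (2 * cos (real N * t))"
  proof -
    have 1: "of_real (2 * cos (real N * t)) = cis (real N * t) + cis (- (real N * t))"
      by (simp add: complex_eq_iff)
    have 2: "cis t ^ (2 * N) = cis (real N * t) * cis (real N * t)" "cis t ^ N = cis (real N * t)"
      by (simp_all only: mult_2 power_add Complex.DeMoivre)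
    have 3: "cis (real N * t) * cis (- (real N * t)) = 1"
      by (simp add: cis_mult)
    show ?thesis
      unfolding 1 2 distrib_left 3 ..
  qed
  then have "poly (T N) (cis t) = cis t ^ 2 * of_real (b t) * (cis t ^ N * of_real (2 * cos (real N * t))) + 2 * cis t ^ (N + 2)"
    by (simp only: T_def poly_add poly_mult poly_monom poly_Q_cis poly_1 mult_1_left)
  also have "\<dots> = cis t ^ (N + 2) * of_real (2 * (b t * cos (real N * t) + 1))"
    by (simp add: power_add power2_eq_square algebra_simps)
  finally show ?thesis
    by (simp only: Complex.DeMoivre)
qed

text \<open>Points with b = 1 or b = -1 yield roots of the nonzero polynomial (Q - x^2) (Q + x^2).
  The endpoint -pi is added separately, since \<open>cis\<close> identifies it with pi.\<close>

lemma finite_b_level: "finite {t\<in>{-pi..pi}. \<bar>b t\<bar> = 1}"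
proof -
  define R where "R = (Q - [:0, 0, 1:]) * (Q + [:0, 0, 1:])"
  have "R \<noteq> 0"
    unfolding R_def Q_def by simp
  then have fin: "finite {z. poly R z = 0}"
    by (rule poly_roots_finite)
  have "poly R (cis t) = 0" if "\<bar>b t\<bar> = 1" for t
  proof -
    have "poly R (cis t) = (cis t ^ 2) ^ 2 * of_real ((b t - 1) * (b t + 1))"
      by (simp only: R_def poly_mult poly_add poly_diff poly_Q_cis) (simp add: algebra_simps power2_eq_square)
    moreover have "(b t - 1) * (b t + 1) = 0"
      using that by auto
    ultimately show ?thesis
      by simp
  qed
  then have "cis ` {t\<in>{-pi<..pi}. \<bar>b t\<bar> = 1} \<subseteq> {z. poly R z = 0}"
    by auto
  moreover have "inj_on cis {t\<in>{-pi<..pi}. \<bar>b t\<bar> = 1}"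
    by (intro inj_on_subset[OF inj_on_cis]) auto
  ultimately have "finite {t\<in>{-pi<..pi}. \<bar>b t\<bar> = 1}"
    using fin inj_on_finite by blast
  then have "finite (insert (-pi) {t\<in>{-pi<..pi}. \<bar>b t\<bar> = 1})"
    by simp
  then show ?thesis
    by (rule rev_finite_subset) auto
qed

lemma T_nonzero: "T N \<noteq> 0"
proof
  assume "T N = 0"
  moreover have "poly (T N) 0 \<noteq> 0"
    by (cases "N = 0") (auto simp: T_def Q_def poly_monom power_0_left)
  ultimately show False
    by simp
qed

sublocale cosine_modulation b "\<lambda>t. - 2 * sin t * (4 * cos t - w - v)"
  "\<lambda>t. - 2 * cos t * (4 * cos t - w - v) + 8 * (sin t)\<^sup>2" T "\<lambda>N. N + 2"
proof
  show "(b has_real_derivative - 2 * sin t * (4 * cos t - w - v)) (at t)" for t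
    unfolding b_def by (auto intro!: derivative_eq_intros simp: algebra_simps)
  show "((\<lambda>t. - 2 * sin t * (4 * cos t - w - v)) has_real_derivative
      - 2 * cos t * (4 * cos t - w - v) + 8 * (sin t)\<^sup>2) (at t)" for t
    by (auto intro!: derivative_eq_intros simp: algebra_simps power2_eq_square)
  show "continuous_on UNIV (\<lambda>t. - 2 * cos t * (4 * cos t - w - v) + 8 * (sin t)\<^sup>2)"
    by (intro continuous_intros)
qed (rule finite_b_level T_nonzero poly_T_cis)+

text \<open>The first factor of b has modulus at least w - 2, so |b| < = 1 confines cos t to a band
  around v / 2 whose half-width can be taken as 1 / (2 (w - 2)).\<close>

lemma b_large:
  assumes "2 * (w - 2) * \<eta> \<ge> 1" "\<bar>cos t - v / 2\<bar> > \<eta>"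
  shows "\<bar>b t\<bar> > 1"
proof -
  have "1 \<le> 2 * (w - 2) * \<eta>"
    by (rule assms(1))
  also have "\<dots> < 2 * (w - 2) * \<bar>cos t - v / 2\<bar>"
    using assms(2) w by (intro mult_strict_left_mono) auto
  also have "\<dots> = (w - 2) * \<bar>2 * cos t - v\<bar>"
    by (simp add: abs_if field_simps)
  also have "\<dots> \<le> \<bar>2 * cos t - w\<bar> * \<bar>2 * cos t - v\<bar>"
    using w cos_le_one[of t] by (intro mult_right_mono) linarith+
  finally show ?thesis
    by (simp add: b_def abs_mult)
qed

text \<open>The angles \<alpha> and \<beta> delimit the band |cos t - v / 2| <= \<eta>, clamped to
  [-1, 1]. Outside it |b| > 1, on three arcs of total length 2 (pi - (\<beta> - \<alpha>));
  \<open>Z_ge\<close> loses 2 on each, whence the 6.\<close>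

lemma Z_lower_bound:
  assumes \<eta>: "2 * (w - 2) * \<eta> \<ge> 1" and "N > 0"
    and \<alpha>: "\<alpha> = arccos (min 1 (v / 2 + \<eta>))" and \<beta>: "\<beta> = arccos (max (-1) (v / 2 - \<eta>))"
  shows "real (Z N (-pi) pi) \<ge> 2 * (1 - (\<beta> - \<alpha>) / pi) * N - 6"
proof -
  have "\<eta> \<ge> 0"
    using \<eta> w by (smt (verit) mult_nonneg_nonpos)
  then have range: "min 1 (v / 2 + \<eta>) \<in> {-1..1}" "max (-1) (v / 2 - \<eta>) \<in> {-1..1}"
    and le: "max (-1) (v / 2 - \<eta>) \<le> min 1 (v / 2 + \<eta>)"
    using v by (auto simp: abs_le_iff)
  have cos_\<alpha>: "cos \<alpha> = min 1 (v / 2 + \<eta>)" and cos_\<beta>: "cos \<beta> = max (-1) (v / 2 - \<eta>)"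
    using range by (auto simp only: \<alpha> \<beta> cos_arccos atLeastAtMost_iff)
  have \<alpha>\<beta>: "0 \<le> \<alpha>" "\<alpha> \<le> \<beta>" "\<beta> \<le> pi"
    using range le unfolding \<alpha> \<beta> by (auto intro!: arccos_le_arccos arccos_lbound arccos_ubound simp del: min.bounded_iff max.bounded_iff)
  have inner: "\<bar>b t\<bar> > 1" if "\<bar>t\<bar> < \<alpha>" for t
  proof -
    have "cos \<bar>t\<bar> > cos \<alpha>"
      using that \<alpha>\<beta> by (intro cos_monotone_0_pi) auto
    then have "cos t > min 1 (v / 2 + \<eta>)"
      using cos_\<alpha> by simp
    then show ?thesis
      using cos_le_one[of t] by (intro b_large[OF \<eta>]) linarith
  qed
  have outer: "\<bar>b t\<bar> > 1" if "\<bar>t\<bar> > \<beta>" "\<bar>t\<bar> \<le> pi" for t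
  proof -
    have "cos \<bar>t\<bar> < cos \<beta>"
      using that \<alpha>\<beta> by (intro cos_monotone_0_pi) auto
    then have "cos t < max (-1) (v / 2 - \<eta>)"
      using cos_\<beta> by simp
    then show ?thesis
      using cos_ge_minus_one[of t] by (intro b_large[OF \<eta>]) linarith
  qed
  have "Z N (-pi) pi \<ge> Z N (-pi) (-\<beta>) + Z N (-\<alpha>) \<alpha> + Z N \<beta> pi"
    using \<alpha>\<beta> Z_split[of "-pi" "-\<beta>" pi N] Z_split[of "-\<beta>" "-\<alpha>" pi N]
      Z_split[of "-\<alpha>" \<alpha> pi N] Z_split[of \<alpha> \<beta> pi N] by simp
  moreover have "real (Z N (-pi) (-\<beta>)) \<ge> (-\<beta> - (-pi)) * N / pi - 2"
    using \<alpha>\<beta> by (intro Z_ge outer \<open>N > 0\<close>) auto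
  moreover have "real (Z N (-\<alpha>) \<alpha>) \<ge> (\<alpha> - (-\<alpha>)) * N / pi - 2"
    using \<alpha>\<beta> by (intro Z_ge inner \<open>N > 0\<close>) auto
  moreover have "real (Z N \<beta> pi) \<ge> (pi - \<beta>) * N / pi - 2"
    using \<alpha>\<beta> by (intro Z_ge outer \<open>N > 0\<close>) auto
  moreover have "(-\<beta> - (-pi)) * N / pi - 2 + ((\<alpha> - (-\<alpha>)) * N / pi - 2) + ((pi - \<beta>) * N / pi - 2)
      = 2 * (1 - (\<beta> - \<alpha>) / pi) * N - 6"
    by (simp add: field_simps)
  ultimately show ?thesis
    by linarith
qed

section \<open>From zero counts to the proportion off the circle\<close>

lemma size_unimodular_proots: "size {#z \<in># proots (T N). cmod z = 1#} = Z N (-pi) pi"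
proof -
  have "set_mset {#z \<in># proots (T N). cmod z = 1#} = {z. poly (T N) z = 0 \<and> cmod z = 1}"
    using T_nonzero by auto
  then have "size {#z \<in># proots (T N). cmod z = 1#}
      = (\<Sum>z | poly (T N) z = 0 \<and> cmod z = 1. count {#z \<in># proots (T N). cmod z = 1#} z)"
    unfolding size_multiset_overloaded_eq by simp
  also have "\<dots> = Z N (-pi) pi"
    unfolding Z_full by (intro sum.cong) (auto simp: T_nonzero)
  finally show ?thesis .
qed

lemma Cratio_T:
  assumes "degree (T N) = 2 * N + 4"
  shows "Cratio (T N) = 1 - real (Z N (-pi) pi) / (2 * real N + 4)"
proof -
  have "size (proots (T N)) = size {#z \<in># proots (T N). cmod z = 1#} + size {#z \<in># proots (T N). cmod z \<noteq> 1#}"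
    by (metis multiset_partition size_union)
  then have "real (2 * N + 4) = real (Z N (-pi) pi) + real (size {#z \<in># proots (T N). cmod z \<noteq> 1#})"
    using assms by (simp only: size_proots_complex size_unimodular_proots of_nat_add)
  then have "real (size {#z \<in># proots (T N). cmod z \<noteq> 1#}) = (2 * real N + 4) - real (Z N (-pi) pi)"
    by simp
  then show ?thesis
    unfolding Cratio_def assms by (simp add: diff_divide_distrib)
qed

text \<open>With L the limit of Z / N, the degree 2 N + 4 makes the proportion tend to 1 - L / 2.
  Existence comes from \<open>Z_convergent\<close>; letting N grow in \<open>Z_lower_bound\<close>
  bounds the limit by the relative length of the band.\<close>

lemma Cratio_T_tendsto:
  assumes deg: "\<And>N. N \<ge> 2 \<Longrightarrow> degree (T N) = 2 * N + 4" and \<eta>: "2 * (w - 2) * \<eta> \<ge> 1"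
  obtains C where "(\<lambda>n. Cratio (T (n + 2))) \<longlonglongrightarrow> C" "0 \<le> C"
    "C \<le> (arccos (max (-1) (v / 2 - \<eta>)) - arccos (min 1 (v / 2 + \<eta>))) / pi"
proof -
  define \<epsilon> where "\<epsilon> = (arccos (max (-1) (v / 2 - \<eta>)) - arccos (min 1 (v / 2 + \<eta>))) / pi"
  obtain L where L: "(\<lambda>N. Z N (-pi) pi / N) \<longlonglongrightarrow> L"
    using Z_convergent by blast
  have "(\<lambda>N. 1 - Z N (-pi) pi / N * (real N / (2 * real N + 4))) \<longlonglongrightarrow> 1 - L * (1 / 2)"
    by (intro tendsto_diff tendsto_mult tendsto_const L) real_asymp
  moreover have "\<forall>\<^sub>F N in sequentially. 1 - Z N (-pi) pi / N * (real N / (2 * real N + 4)) = Cratio (T N)"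
    using eventually_ge_at_top[of 2]
  proof eventually_elim
    case (elim N)
    then show ?case
      using Cratio_T[OF deg[OF elim]] by simp
  qed
  ultimately have lim: "(\<lambda>N. Cratio (T N)) \<longlonglongrightarrow> 1 - L * (1 / 2)"
    by (rule Lim_transform_eventually)
  have "(\<lambda>N. 2 * (1 - \<epsilon>) - 6 / real N) \<longlonglongrightarrow> 2 * (1 - \<epsilon>)"
    by real_asymp
  moreover have "2 * (1 - \<epsilon>) - 6 / real N \<le> Z N (-pi) pi / N" if "N \<ge> 1" for N
  proof -
    have "2 * (1 - \<epsilon>) * N - 6 \<le> Z N (-pi) pi"
      unfolding \<epsilon>_def using Z_lower_bound[OF \<eta> _ refl refl] that by simp
    then have "(2 * (1 - \<epsilon>) * N - 6) / N \<le> Z N (-pi) pi / N"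
      by (rule divide_right_mono) simp
    then show ?thesis
      using that by (simp add: diff_divide_distrib)
  qed
  ultimately have "2 * (1 - \<epsilon>) \<le> L"
    using L by (intro LIMSEQ_le[of _ _ _ L]) blast+
  then have "1 - L * (1 / 2) \<le> \<epsilon>"
    by (simp add: algebra_simps)
  moreover have "0 \<le> 1 - L * (1 / 2)"
    by (rule LIMSEQ_le_const[OF lim]) (auto simp: Cratio_def)
  ultimately show ?thesis
    using that[OF LIMSEQ_ignore_initial_segment[OF lim, of 2]] unfolding \<epsilon>_def by blast
qed

end

section \<open>Conjugation over the square root of 13\<close>

text \<open>A rational algebraic integer is an integer, but 13 lies strictly between the squares of
  3 and 4.\<close>

lemma sqrt_13_irrational: "sqrt 13 \<notin> \<rat>"
proof
  assume "sqrt 13 \<in> \<rat>"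
  moreover have "algebraic_int (sqrt 13)"
    by auto
  ultimately obtain k :: int where k: "sqrt 13 = of_int k"
    using rational_algebraic_int_is_int by (metis Ints_cases)
  then have "real_of_int (k ^ 2) = 13"
    by (metis of_int_power real_sqrt_pow2_iff zero_le_numeral)
  then have "k ^ 2 = 13"
    by linarith
  then have "\<bar>k\<bar> ^ 2 = 13"
    by simp
  moreover have "\<bar>k\<bar> \<le> 3 \<or> \<bar>k\<bar> \<ge> 4"
    by linarith
  then have "\<bar>k\<bar> ^ 2 \<le> 3 ^ 2 \<or> \<bar>k\<bar> ^ 2 \<ge> 4 ^ 2"
    using power_mono[of "\<bar>k\<bar>" 3 2] power_mono[of 4 "\<bar>k\<bar>" 2] by auto
  ultimately show False
    by simp
qed

lemma sqrt_13_independent: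
  fixes r s :: rat
  assumes "of_rat r + of_rat s * sqrt 13 = 0"
  shows "r = 0 \<and> s = 0"
proof -
  have "s = 0"
  proof (rule ccontr)
    assume "s \<noteq> 0"
    then have "sqrt 13 = of_rat (- r / s)"
      using assms by (simp add: of_rat_divide of_rat_minus field_simps)
    then show False
      using sqrt_13_irrational by auto
  qed
  then show ?thesis
    using assms by simp
qed

text \<open>The graph of the nontrivial automorphism of \<rat>(sqrt 13). As a relation it needs no
  separate field type, and the closure lemmas below play the role of the homomorphism laws.\<close>

definition quad_conj :: "real \<Rightarrow> real \<Rightarrow> bool" where
  "quad_conj x y \<longleftrightarrow> (\<exists>r s :: rat. x = of_rat r + of_rat s * sqrt 13 \<and> y = of_rat r - of_rat s * sqrt 13)"

lemma quad_conj_of_rat: "quad_conj (of_rat r) (of_rat r)"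
  unfolding quad_conj_def by (intro exI[of _ r] exI[of _ 0]) simp

lemma quad_conj_add: "quad_conj x y \<Longrightarrow> quad_conj x' y' \<Longrightarrow> quad_conj (x + x') (y + y')"
  unfolding quad_conj_def
proof safe
  fix r s r' s' :: rat
  show "\<exists>r'' s''. of_rat r + of_rat s * sqrt 13 + (of_rat r' + of_rat s' * sqrt 13) = of_rat r'' + of_rat s'' * sqrt 13 \<and>
      of_rat r - of_rat s * sqrt 13 + (of_rat r' - of_rat s' * sqrt 13) = of_rat r'' - of_rat s'' * sqrt 13"
    by (intro exI[of _ "r + r'"] exI[of _ "s + s'"]) (simp add: of_rat_add algebra_simps)
qed

lemma quad_conj_mult: "quad_conj x y \<Longrightarrow> quad_conj x' y' \<Longrightarrow> quad_conj (x * x') (y * y')"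
  unfolding quad_conj_def
proof safe
  fix r s r' s' :: rat
  have "sqrt 13 * (sqrt 13 * x) = 13 * x" for x
    by (simp flip: mult.assoc)
  then show "\<exists>r'' s''. (of_rat r + of_rat s * sqrt 13) * (of_rat r' + of_rat s' * sqrt 13) = of_rat r'' + of_rat s'' * sqrt 13 \<and>
      (of_rat r - of_rat s * sqrt 13) * (of_rat r' - of_rat s' * sqrt 13) = of_rat r'' - of_rat s'' * sqrt 13"
    by (intro exI[of _ "r * r' + 13 * s * s'"] exI[of _ "r * s' + s * r'"])
       (simp add: of_rat_add of_rat_mult algebra_simps)
qed

lemma quad_conj_diff:
  assumes "quad_conj x y" "quad_conj x' y'"
  shows "quad_conj (x - x') (y - y')"
  using quad_conj_add[OF assms(1) quad_conj_mult[OF quad_conj_of_rat[of "-1"] assms(2)]]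
  by (simp add: of_rat_minus)

lemma quad_conj_0: "quad_conj 0 y \<Longrightarrow> y = 0"
  unfolding quad_conj_def using sqrt_13_independent by fastforce

text \<open>A rational number is fixed by conjugation, so a rational v would force w = v.\<close>

lemma quad_conj_irrational:
  assumes "quad_conj w v" "w \<noteq> v"
  shows "v \<notin> \<rat>"
proof
  assume "v \<in> \<rat>"
  then obtain q where q: "v = of_rat q"
    by (rule Rats_cases)
  obtain r s where rs: "w = of_rat r + of_rat s * sqrt 13" "v = of_rat r - of_rat s * sqrt 13"
    using assms(1) by (auto simp: quad_conj_def)
  then have "of_rat (q - r) + of_rat s * sqrt 13 = 0"
    using q by (simp add: of_rat_diff)
  then show False
    using sqrt_13_independent rs assms(2) by fastforce
qed

lemma rational_linear_independent:
  fixes a b :: rat and v :: real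
  assumes "of_rat a + of_rat b * v = 0" "v \<notin> \<rat>"
  shows "a = 0 \<and> b = 0"
proof -
  have "b = 0"
  proof (rule ccontr)
    assume "b \<noteq> 0"
    then have "v = of_rat (- a / b)"
      using assms by (simp add: of_rat_divide of_rat_minus field_simps)
    then show False
      using assms(2) by auto
  qed
  then show ?thesis
    using assms by simp
qed

text \<open>Reducing a cubic relation modulo \<open>x\<^sup>2 - w x + 1\<close> leaves \<open>\<alpha> x + \<beta> = 0\<close>, whence
  \<open>\<beta>\<^sup>2 + w \<alpha> \<beta> + \<alpha>\<^sup>2 = 0\<close>. The conjugate of this identity is a positive definite form in the
  conjugates of \<open>\<alpha>\<close> and \<open>\<beta>\<close>, because \<open>\<bar>v\<bar> < 2\<close>.\<close>

lemma no_rational_cubic_relation: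
  fixes q0 q1 q2 q3 :: rat and x w v :: real
  assumes conj: "quad_conj w v" and v: "\<bar>v\<bar> \<le> 2" and w: "w > 2"
    and x: "x\<^sup>2 - w * x + 1 = 0"
    and rel: "of_rat q0 + of_rat q1 * x + of_rat q2 * x ^ 2 + of_rat q3 * x ^ 3 = 0"
  shows "q0 = 0 \<and> q1 = 0 \<and> q2 = 0 \<and> q3 = 0"
proof -
  have irr: "v \<notin> \<rat>"
    using quad_conj_irrational[OF conj] v w by auto
  then have "v \<noteq> 2" "v \<noteq> -2"
    using Rats_number_of[of "num.Bit0 num.One"] by (auto simp: Rats_minus_iff)
  then have "\<bar>v\<bar> < 2"
    using v by linarith
  then have v2: "v\<^sup>2 < 4"
    using power_strict_mono[of "\<bar>v\<bar>" 2 2] by simp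
  \<comment> \<open>The remainder coefficients are kept as functions of u, so that u = w and its
    conjugate u = v can both be inserted.\<close>
  define \<alpha> where "\<alpha> u = of_rat (q1 - q3) + of_rat q2 * u + of_rat q3 * (u * u)" for u :: real
  define \<beta> where "\<beta> u = of_rat (q0 - q2) - of_rat q3 * u" for u :: real
  have x2: "x\<^sup>2 = w * x - 1"
    using x by simp
  have x3: "x ^ 3 = (w * w - 1) * x - w"
  proof -
    have "x ^ 3 = x * x\<^sup>2"
      by (simp add: power2_eq_square power3_eq_cube)
    also have "\<dots> = x * (w * x - 1)"
      by (simp only: x2)
    also have "\<dots> = w * x\<^sup>2 - x"
      by (simp add: algebra_simps power2_eq_square)
    also have "\<dots> = w * (w * x - 1) - x"
      by (simp only: x2)
    finally show ?thesis
      by (simp add: algebra_simps)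
  qed
  have \<beta>_w: "\<beta> w = - \<alpha> w * x"
    using rel unfolding x2 x3 \<alpha>_def \<beta>_def of_rat_diff by (simp add: algebra_simps)
  have "\<beta> w * \<beta> w + w * (\<alpha> w * \<beta> w) + \<alpha> w * \<alpha> w = \<alpha> w * \<alpha> w * (x\<^sup>2 - w * x + 1)"
    unfolding \<beta>_w by (simp add: algebra_simps power2_eq_square)
  also have "\<dots> = 0"
    using x by simp
  finally have form_w: "\<beta> w * \<beta> w + w * (\<alpha> w * \<beta> w) + \<alpha> w * \<alpha> w = 0" .
  have "quad_conj (\<beta> w * \<beta> w + w * (\<alpha> w * \<beta> w) + \<alpha> w * \<alpha> w) (\<beta> v * \<beta> v + v * (\<alpha> v * \<beta> v) + \<alpha> v * \<alpha> v)"
    unfolding \<alpha>_def \<beta>_def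
    by (intro quad_conj_add quad_conj_mult quad_conj_diff quad_conj_of_rat conj)
  then have "\<beta> v * \<beta> v + v * (\<alpha> v * \<beta> v) + \<alpha> v * \<alpha> v = 0"
    unfolding form_w by (rule quad_conj_0)
  then have sq: "(\<beta> v + v / 2 * \<alpha> v)\<^sup>2 + (1 - v\<^sup>2 / 4) * (\<alpha> v)\<^sup>2 = 0"
    by (simp add: power2_eq_square field_simps)
  have "(1 - v\<^sup>2 / 4) * (\<alpha> v)\<^sup>2 \<ge> 0"
    using v2 by (intro mult_nonneg_nonneg) auto
  then have "(1 - v\<^sup>2 / 4) * (\<alpha> v)\<^sup>2 = 0" "(\<beta> v + v / 2 * \<alpha> v)\<^sup>2 = 0"
    using sq by (smt (verit) zero_le_power2)+
  then have \<alpha>0: "\<alpha> v = 0" and \<beta>0: "\<beta> v = 0"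
    using v2 by auto
  \<comment> \<open>Irrationality of v now separates coefficients: first
    \<open>\<beta> v = 0\<close> kills q3 and gives q0 = q2, then \<open>\<alpha> v = 0\<close>
    kills q1 and q2.\<close>
  have "of_rat (q0 - q2) + of_rat (- q3) * v = 0"
    using \<beta>0 by (simp add: \<beta>_def of_rat_minus)
  then have q3: "q3 = 0" "q0 = q2"
    using rational_linear_independent[OF _ irr] by fastforce+
  then have "of_rat q1 + of_rat q2 * v = 0"
    using \<alpha>0 by (simp add: \<alpha>_def)
  then show ?thesis
    using rational_linear_independent[OF _ irr] q3 by blast
qed

lemma complex_of_rat: "(of_rat r :: complex) = of_real (of_rat r)"
  by (cases r) (simp add: of_rat_rat)

text \<open>The coefficients are rational because w + v and w v are the trace and norm of w. A
  rational polynomial of smaller degree vanishing at x would be a cubic relation, which is excluded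
  above.\<close>

lemma is_min_poly_rat_quartic:
  fixes x w v :: real
  assumes conj: "quad_conj w v" and v: "\<bar>v\<bar> \<le> 2" and w: "w > 2" and x: "x\<^sup>2 - w * x + 1 = 0"
  shows "\<exists>p. map_poly of_rat p = [:1, - of_real (w + v), of_real (2 + w * v), - of_real (w + v), 1 :: complex:]
    \<and> is_min_poly_rat p (of_real x)"
proof -
  obtain r s where rs: "w = of_rat r + of_rat s * sqrt 13" "v = of_rat r - of_rat s * sqrt 13"
    using conj by (auto simp: quad_conj_def)
  define p where "p = [:1, - 2 * r, 2 + (r * r - 13 * s * s), - 2 * r, 1:]"
  have sum: "w + v = of_rat (2 * r)"
    by (simp add: rs of_rat_mult)
  have prod: "2 + w * v = of_rat (2 + (r * r - 13 * s * s))"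
    by (simp add: rs of_rat_add of_rat_diff of_rat_mult algebra_simps)
  have map_p: "map_poly of_rat p = [:1, - of_real (w + v), of_real (2 + w * v), - of_real (w + v), 1 :: complex:]"
    unfolding sum prod complex_of_rat[symmetric] by (simp add: p_def map_poly_pCons of_rat_minus of_rat_mult)
  have "poly (map_poly of_rat p) (complex_of_real x) = of_real ((x\<^sup>2 - w * x + 1) * (x\<^sup>2 - v * x + 1))"
    unfolding map_p by (simp add: algebra_simps power2_eq_square)
  then have root: "poly (map_poly of_rat p) (complex_of_real x) = 0"
    using x by simp
  have "degree p \<le> degree q" if q: "q \<noteq> 0" "poly (map_poly of_rat q) (complex_of_real x) = 0" for q
  proof (rule ccontr)
    assume "\<not> degree p \<le> degree q"
    then have deg: "degree q \<le> 3"
      by (simp add: p_def)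
    have "poly (map_poly of_rat q) (complex_of_real x) =
        (\<Sum>i\<le>degree q. of_rat (coeff q i) * complex_of_real x ^ i)"
      by (simp add: poly_altdef coeff_map_poly degree_map_poly)
    also have "\<dots> = (\<Sum>i\<le>3. of_rat (coeff q i) * complex_of_real x ^ i)"
      using deg by (intro sum.mono_neutral_left) (auto simp: coeff_eq_0)
    also have "\<dots> = of_real (\<Sum>i\<le>3. of_rat (coeff q i) * x ^ i)"
      by (simp add: complex_of_rat)
    finally have "(\<Sum>i\<le>3. of_rat (coeff q i) * x ^ i) = 0"
      using q(2) by (metis of_real_eq_0_iff)
    then have "of_rat (coeff q 0) + of_rat (coeff q 1) * x + of_rat (coeff q 2) * x ^ 2 + of_rat (coeff q 3) * x ^ 3 = 0"
      by (simp add: numeral_eq_Suc algebra_simps)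
    then have "coeff q 0 = 0 \<and> coeff q 1 = 0 \<and> coeff q 2 = 0 \<and> coeff q 3 = 0"
      by (rule no_rational_cubic_relation[OF assms])
    moreover have "degree q \<in> {0, 1, 2, 3}"
      using deg by auto
    ultimately have "coeff q (degree q) = 0"
      by (elim insertE) (simp_all only: empty_iff)
    then show False
      using q(1) by simp
  qed
  then have "is_min_poly_rat p (of_real x)"
    using root by (simp add: is_min_poly_rat_def) (simp add: p_def)
  with map_p show ?thesis
    by blast
qed

section \<open>The Salem number\<close>

text \<open>The quartic splits as (z^2 - w z + 1) (z^2 - v z + 1) with w + v = 1 and w v = -3. As v
  < 0, the positive number \<gamma> belongs to the first factor, whose roots \<gamma> and 1 /
  \<gamma> are real. So \<theta> belongs to the second, and real and imaginary parts give its trace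
  and modulus.\<close>

lemma salem_quartic_roots:
  fixes \<gamma> :: real and \<theta> :: complex
  assumes "\<gamma> > 1" "poly salem_quartic (of_real \<gamma>) = 0" "poly salem_quartic \<theta> = 0" "\<theta> \<notin> \<real>"
  shows "\<gamma> + inverse \<gamma> = (1 + sqrt 13) / 2" "cmod \<theta> = 1" "2 * Re \<theta> = (1 - sqrt 13) / 2"
proof -
  define w v :: real where "w = (1 + sqrt 13) / 2" and "v = (1 - sqrt 13) / 2"
  have wv: "w + v = 1" "w * v = -3"
    by (auto simp: w_def v_def field_simps)
  have quartic: "poly salem_quartic z = (z\<^sup>2 - of_real w * z + 1) * (z\<^sup>2 - of_real v * z + 1)" for z
  proof -
    have "(z\<^sup>2 - of_real w * z + 1) * (z\<^sup>2 - of_real v * z + 1) =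
        z ^ 4 - of_real (w + v) * z ^ 3 + of_real (2 + w * v) * z\<^sup>2 - of_real (w + v) * z + 1"
      by (simp add: algebra_simps power2_eq_square power3_eq_cube power4_eq_xxxx)
    then show ?thesis
      unfolding wv poly_salem_quartic by simp
  qed
  have "v < 0"
    using real_sqrt_less_mono[of 1 13] by (simp add: v_def)
  then have "v * \<gamma> < 0"
    using assms(1) by (intro mult_neg_pos) auto
  then have "\<gamma>\<^sup>2 - v * \<gamma> + 1 \<noteq> 0"
    by (smt (verit) zero_le_power2)
  moreover have "complex_of_real ((\<gamma>\<^sup>2 - w * \<gamma> + 1) * (\<gamma>\<^sup>2 - v * \<gamma> + 1)) = 0"
    using assms(2) unfolding quartic by simp
  ultimately have \<gamma>: "\<gamma>\<^sup>2 - w * \<gamma> + 1 = 0"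
    unfolding of_real_eq_0_iff by simp
  then have \<gamma>_w: "\<gamma> + inverse \<gamma> = w"
    using assms(1) by (simp add: field_simps power2_eq_square)
  then show "\<gamma> + inverse \<gamma> = (1 + sqrt 13) / 2"
    by (simp add: w_def)
  have "\<theta>\<^sup>2 - of_real w * \<theta> + 1 = (\<theta> - of_real \<gamma>) * (\<theta> - of_real (inverse \<gamma>))"
    unfolding \<gamma>_w[symmetric] using assms(1) by (simp add: algebra_simps power2_eq_square)
  moreover have "\<theta> \<noteq> of_real \<gamma>" "\<theta> \<noteq> of_real (inverse \<gamma>)"
    using assms(4) by (metis Reals_of_real)+
  ultimately have "\<theta>\<^sup>2 - of_real w * \<theta> + 1 \<noteq> 0"
    by simp
  then have \<theta>: "\<theta>\<^sup>2 - of_real v * \<theta> + 1 = 0"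
    using assms(3) unfolding quartic by simp
  have "Im \<theta> \<noteq> 0"
    using assms(4) by (simp add: complex_is_Real_iff)
  moreover have "Im \<theta> * (2 * Re \<theta> - v) = 0"
    using arg_cong[OF \<theta>, of Im] by (simp add: power2_eq_square algebra_simps)
  ultimately have v: "v = 2 * Re \<theta>"
    by simp
  then show "2 * Re \<theta> = (1 - sqrt 13) / 2"
    by (simp add: v_def)
  have "(Re \<theta>)\<^sup>2 + (Im \<theta>)\<^sup>2 = 1"
    using arg_cong[OF \<theta>, of Re] unfolding v by (simp add: power2_eq_square algebra_simps)
  then show "cmod \<theta> = 1"
    by (simp add: cmod_def)
qed

definition salem_trace :: "real \<Rightarrow> nat \<Rightarrow> real" where
  "salem_trace \<gamma> m = \<gamma> ^ m + inverse \<gamma> ^ m"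

definition circle_trace :: "complex \<Rightarrow> nat \<Rightarrow> real" where
  "circle_trace \<theta> m = 2 * Re (\<theta> ^ m)"

context
  fixes \<gamma> :: real and \<theta> :: complex
  assumes \<gamma>_gt_1: "\<gamma> > 1" and \<gamma>_root: "poly salem_quartic (of_real \<gamma>) = 0"
    and \<theta>_root: "poly salem_quartic \<theta> = 0" and \<theta>_nonreal: "\<theta> \<notin> \<real>"
begin

lemmas roots = salem_quartic_roots[OF \<gamma>_gt_1 \<gamma>_root \<theta>_root \<theta>_nonreal]

lemma salem_trace_rec: "salem_trace \<gamma> (Suc (Suc m)) = (1 + sqrt 13) / 2 * salem_trace \<gamma> (Suc m) - salem_trace \<gamma> m"
  unfolding salem_trace_def roots(1)[symmetric] using \<gamma>_gt_1 by (simp add: field_simps)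

lemma circle_trace_rec: "circle_trace \<theta> (Suc (Suc m)) = (1 - sqrt 13) / 2 * circle_trace \<theta> (Suc m) - circle_trace \<theta> m"
proof -
  have "(Re \<theta>)\<^sup>2 + (Im \<theta>)\<^sup>2 = 1"
    using roots(2) by (metis cmod_power2 one_power2)
  then have "\<theta> * \<theta> = of_real (2 * Re \<theta>) * \<theta> - 1"
    by (simp add: complex_eq_iff power2_eq_square algebra_simps)
  then have "\<theta> * \<theta> * \<theta> ^ m = (of_real (2 * Re \<theta>) * \<theta> - 1) * \<theta> ^ m"
    by simp
  then have "\<theta> ^ Suc (Suc m) = of_real (2 * Re \<theta>) * \<theta> ^ Suc m - \<theta> ^ m"
    by (simp add: algebra_simps)
  then have "Re (\<theta> ^ Suc (Suc m)) = 2 * Re \<theta> * Re (\<theta> ^ Suc m) - Re (\<theta> ^ m)"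
    by (simp only: minus_complex.simps Re_complex_of_real times_complex.simps Im_complex_of_real mult_zero_left diff_zero)
  then show ?thesis
    unfolding circle_trace_def roots(3)[symmetric] by (simp only: right_diff_distrib mult.left_commute)
qed

text \<open>Both sequences start from 2, have conjugate second terms and satisfy second-order
  recurrences with conjugate coefficients.\<close>

lemma quad_conj_traces: "quad_conj (salem_trace \<gamma> m) (circle_trace \<theta> m)"
proof (induction m rule: induct_nat_012)
  have base: "quad_conj ((1 + sqrt 13) / 2) ((1 - sqrt 13) / 2)"
    unfolding quad_conj_def
    by (intro exI[of _ "1 / 2"]) (simp add: of_rat_divide field_simps)
  case 0
  show ?case
    using quad_conj_of_rat[of 2] by (simp add: salem_trace_def circle_trace_def)
  case 1
  show ?case
  proof -
    have "salem_trace \<gamma> 1 = (1 + sqrt 13) / 2" "circle_trace \<theta> 1 = (1 - sqrt 13) / 2"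
      unfolding salem_trace_def circle_trace_def power_one_right by (rule roots)+
    with base show ?thesis
      by (simp only: One_nat_def)
  qed
  case (ge2 m)
  then show ?case
    unfolding salem_trace_rec circle_trace_rec by (intro quad_conj_diff quad_conj_mult base)
qed

lemma salem_trace_gt_2:
  assumes "m \<ge> 1"
  shows "salem_trace \<gamma> m > 2"
proof -
  have "\<gamma> ^ m > 1"
    using \<gamma>_gt_1 assms by (simp add: one_less_power)
  \<comment> \<open>This is the identity y + 1 / y - 2 = (y - 1)^2 / y.\<close>
  then have "(\<gamma> ^ m - 1) * (\<gamma> ^ m - 1) / \<gamma> ^ m > 0"
    by (intro divide_pos_pos mult_pos_pos) auto
  moreover have "(\<gamma> ^ m - 1) * (\<gamma> ^ m - 1) / \<gamma> ^ m = salem_trace \<gamma> m - 2"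
    using \<gamma>_gt_1 by (simp add: salem_trace_def field_simps)
  ultimately show ?thesis
    by simp
qed

lemma abs_circle_trace_le: "\<bar>circle_trace \<theta> m\<bar> \<le> 2"
  using abs_Re_le_cmod[of "\<theta> ^ m"] roots(2) by (simp add: circle_trace_def norm_power)

lemma traces_reciprocal_quartic: "m \<ge> 1 \<Longrightarrow> reciprocal_quartic (salem_trace \<gamma> m) (circle_trace \<theta> m)"
  by unfold_locales (rule salem_trace_gt_2 abs_circle_trace_le; assumption?)+

lemma bcoeff_eq:
  "bcoeff \<gamma> \<theta> 1 m = - of_real (salem_trace \<gamma> m + circle_trace \<theta> m)" "bcoeff \<gamma> \<theta> 3 m = - of_real (salem_trace \<gamma> m + circle_trace \<theta> m)"
  "bcoeff \<gamma> \<theta> 2 m = of_real (2 + salem_trace \<gamma> m * circle_trace \<theta> m)"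
proof -
  have v: "of_real (circle_trace \<theta> m) = \<theta> ^ m + cnj \<theta> ^ m"
    by (simp add: circle_trace_def complex_eq_iff flip: complex_cnj_power)
  have w: "of_real (salem_trace \<gamma> m) = of_real \<gamma> ^ m + inverse (complex_of_real \<gamma>) ^ m"
    by (simp add: salem_trace_def)
  show "bcoeff \<gamma> \<theta> 1 m = - of_real (salem_trace \<gamma> m + circle_trace \<theta> m)" "bcoeff \<gamma> \<theta> 3 m = - of_real (salem_trace \<gamma> m + circle_trace \<theta> m)"
    unfolding of_real_add w v bcoeff_def Let_def by simp_all
  have "bcoeff \<gamma> \<theta> 2 m = 2 + (of_real \<gamma> ^ m + inverse (of_real \<gamma>) ^ m) * (\<theta> ^ m + cnj \<theta> ^ m)"
    unfolding bcoeff_def Let_def by (simp only: distrib_left distrib_right mult.commute) simp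
  then show "bcoeff \<gamma> \<theta> 2 m = of_real (2 + salem_trace \<gamma> m * circle_trace \<theta> m)"
    by (simp only: of_real_add of_real_mult of_real_numeral w v)
qed

lemma Bpoly_eq: "Bpoly \<gamma> \<theta> m = [:1, - of_real (salem_trace \<gamma> m + circle_trace \<theta> m), of_real (2 + salem_trace \<gamma> m * circle_trace \<theta> m), - of_real (salem_trace \<gamma> m + circle_trace \<theta> m), 1:]"
  unfolding Bpoly_def bcoeff_eq ..

lemma Tpoly_eq:
  assumes "m \<ge> 1"
  shows "Tpoly \<gamma> \<theta> n m = reciprocal_quartic.T (salem_trace \<gamma> m) (circle_trace \<theta> m) (n + 2)"
proof -
  interpret reciprocal_quartic "salem_trace \<gamma> m" "circle_trace \<theta> m"
    by (rule traces_reciprocal_quartic[OF assms])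
  have b0: "bcoeff \<gamma> \<theta> 0 m = 1" "bcoeff \<gamma> \<theta> 4 m = 1"
    by (simp_all add: bcoeff_def)
  have "{..4} = {0, 1, 2, 3, 4::nat}"
    by auto
  then have "poly (Tpoly \<gamma> \<theta> n m) x = poly (T (n + 2)) x" for x
    unfolding T_def Tpoly_def Q_def
    by (simp add: poly_monom b0 bcoeff_eq[unfolded One_nat_def] power_add power_numeral_reduce algebra_simps)
  then show ?thesis
    by (simp add: poly_eq_poly_eq_iff[symmetric] fun_eq_iff)
qed

lemma Cratio_Tpoly_tendsto:
  assumes "m \<ge> 1" "2 * (salem_trace \<gamma> m - 2) * \<eta> \<ge> 1"
  obtains C where "(\<lambda>n. Cratio (Tpoly \<gamma> \<theta> n m)) \<longlonglongrightarrow> C" "0 \<le> C"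
    "C \<le> (arccos (max (-1) (circle_trace \<theta> m / 2 - \<eta>)) - arccos (min 1 (circle_trace \<theta> m / 2 + \<eta>))) / pi"
proof -
  interpret reciprocal_quartic "salem_trace \<gamma> m" "circle_trace \<theta> m"
    by (rule traces_reciprocal_quartic[OF assms(1)])
  have deg: "degree (T N) = 2 * N + 4" if "N \<ge> 2" for N
  proof -
    have "N = (N - 2) + 2"
      using that by simp
    then have "degree (T N) = degree (Tpoly \<gamma> \<theta> (N - 2) m)"
      by (simp only: Tpoly_eq[OF assms(1)])
    then show ?thesis
      using that by (simp add: degree_Tpoly)
  qed
  obtain C where "(\<lambda>n. Cratio (T (n + 2))) \<longlonglongrightarrow> C" "0 \<le> C"
    "C \<le> (arccos (max (-1) (circle_trace \<theta> m / 2 - \<eta>)) - arccos (min 1 (circle_trace \<theta> m / 2 + \<eta>))) / pi"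
    using deg assms(2) by (rule Cratio_T_tendsto)
  then show ?thesis
    by (intro that) (simp_all only: Tpoly_eq[OF assms(1)])
qed

lemma Cratio_Tpoly_convergent:
  assumes "m \<ge> 1"
  shows "convergent (\<lambda>n. Cratio (Tpoly \<gamma> \<theta> n m))"
proof -
  \<comment> \<open>For convergence alone any admissible \<eta> will do; this is the smallest
    one.\<close>
  have "2 * (salem_trace \<gamma> m - 2) * (1 / (2 * (salem_trace \<gamma> m - 2))) \<ge> 1"
    using salem_trace_gt_2[OF assms] by simp
  then obtain C where "(\<lambda>n. Cratio (Tpoly \<gamma> \<theta> n m)) \<longlonglongrightarrow> C"
    by (rule Cratio_Tpoly_tendsto[OF assms])
  then show ?thesis
    by (rule convergentI)
qed

text \<open>The centre v / 2 of the band moves with m and may come near 1 or -1, where arccos is not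
  Lipschitz. Uniform continuity of arccos on [-1, 1] makes the arc short wherever the band
  lies.\<close>

lemma LC_tendsto_0: "LC \<gamma> \<theta> \<longlonglongrightarrow> 0"
proof (rule LIMSEQ_I)
  fix r :: real assume r: "r > 0"
  have "uniformly_continuous_on {-1..1} arccos"
    by (intro compact_uniformly_continuous continuous_on_arccos') auto
  then obtain d where d: "d > 0"
    "\<And>x y. x \<in> {-1..1} \<Longrightarrow> y \<in> {-1..1} \<Longrightarrow> dist y x < d \<Longrightarrow> dist (arccos y) (arccos x) < r * pi"
    unfolding uniformly_continuous_on_def using r by (metis mult_pos_pos pi_gt_zero)
  define \<eta> where "\<eta> = d / 3"
  have \<eta>: "\<eta> > 0" "2 * \<eta> < d"
    using d(1) by (auto simp: \<eta>_def)
  \<comment> \<open>This threshold makes 2 (w - 2) \<eta> >= 1, the condition under which |b| > 1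
    outside the band of half-width \<eta>.\<close>
  obtain M where "2 + 1 / (2 * \<eta>) < \<gamma> ^ M"
    using real_arch_pow[OF \<gamma>_gt_1] by blast
  then have M: "\<gamma> ^ m > 2 + 1 / (2 * \<eta>)" if "m \<ge> M" for m
    using power_increasing[OF that less_imp_le[OF \<gamma>_gt_1]] by linarith
  have "norm (LC \<gamma> \<theta> m - 0) < r" if m: "m \<ge> max M 1" for m
  proof -
    have m1: "m \<ge> 1"
      using m by simp
    have "salem_trace \<gamma> m \<ge> \<gamma> ^ m"
      using \<gamma>_gt_1 by (simp add: salem_trace_def)
    then have "salem_trace \<gamma> m - 2 \<ge> 1 / (2 * \<eta>)"
      using M[of m] m by simp
    then have "2 * (salem_trace \<gamma> m - 2) * \<eta> \<ge> 1"
      using \<eta>(1) by (simp add: field_simps)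
    then obtain C where C: "(\<lambda>n. Cratio (Tpoly \<gamma> \<theta> n m)) \<longlonglongrightarrow> C" "0 \<le> C"
      "C \<le> (arccos (max (-1) (circle_trace \<theta> m / 2 - \<eta>)) - arccos (min 1 (circle_trace \<theta> m / 2 + \<eta>))) / pi"
      by (rule Cratio_Tpoly_tendsto[OF m1])
    have "min 1 (circle_trace \<theta> m / 2 + \<eta>) \<in> {-1..1}" "max (-1) (circle_trace \<theta> m / 2 - \<eta>) \<in> {-1..1}"
      "dist (max (-1) (circle_trace \<theta> m / 2 - \<eta>)) (min 1 (circle_trace \<theta> m / 2 + \<eta>)) < d"
      using abs_circle_trace_le[of m] \<eta> by (auto simp: dist_real_def abs_le_iff min_def max_def)
    then have "dist (arccos (max (-1) (circle_trace \<theta> m / 2 - \<eta>))) (arccos (min 1 (circle_trace \<theta> m / 2 + \<eta>))) < r * pi"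
      by (rule d(2))
    then have "(arccos (max (-1) (circle_trace \<theta> m / 2 - \<eta>)) - arccos (min 1 (circle_trace \<theta> m / 2 + \<eta>))) / pi < r"
      by (simp add: dist_real_def pos_divide_less_eq)
    moreover have "LC \<gamma> \<theta> m = C"
      unfolding LC_def by (rule limI[OF C(1)])
    ultimately show ?thesis
      using C(2,3) by simp
  qed
  then show "\<exists>M. \<forall>m\<ge>M. norm (LC \<gamma> \<theta> m - 0) < r"
    by blast
qed

lemma is_min_poly_rat_Bpoly:
  assumes "m \<ge> 1"
  shows "\<exists>p. map_poly of_rat p = Bpoly \<gamma> \<theta> m \<and> is_min_poly_rat p (of_real (\<gamma> ^ m))"
  unfolding Bpoly_eq
proof (rule is_min_poly_rat_quartic[OF quad_conj_traces abs_circle_trace_le salem_trace_gt_2[OF assms]])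
  show "(\<gamma> ^ m)\<^sup>2 - salem_trace \<gamma> m * \<gamma> ^ m + 1 = 0"
    using \<gamma>_gt_1 by (simp add: salem_trace_def field_simps power2_eq_square)
qed

end

text \<open>Since \<open>lim\<close> denotes a genuine limit only for convergent sequences, the
  second conjunct certifies that \<open>LC\<close> is the intended limit. The first conjunct is the
  assertion about the minimal polynomial of \<open>\<gamma> ^ m\<close>.\<close>

theorem theorem3:
  fixes \<gamma> :: real and \<theta> :: complex
  assumes "salem_number \<gamma>" and "poly salem_quartic (of_real \<gamma>) = 0"
    and "poly salem_quartic \<theta> = 0" and "\<theta> \<notin> \<real>"
  shows "(\<forall>m\<ge>1. \<exists>p. map_poly of_rat p = Bpoly \<gamma> \<theta> m \<and> is_min_poly_rat p (of_real (\<gamma> ^ m)))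
    \<and> (\<forall>m\<ge>1. convergent (\<lambda>n. Cratio (Tpoly \<gamma> \<theta> n m)))
    \<and> (LC \<gamma> \<theta> \<longlonglongrightarrow> 0)"
proof -
  have "\<gamma> > 1"
    using assms(1) by (simp add: salem_number_def)
  note roots = this assms(2-4)
  show ?thesis
    using is_min_poly_rat_Bpoly[OF roots] Cratio_Tpoly_convergent[OF roots] LC_tendsto_0[OF roots] by blast
qed

end
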